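(* Let $\mathbf M$ be an ascending Motzkin path with $m_1=0$ and let $T_{\mathbf M}$, its edge weights and its lattice paths be as defined in the context. Let $1\le k\le r$ and $n\ge k-1$, and put $A_i=(2i-2,0)$, $E_i=(2n+2k-2i,0)$ for $i=1,\dots,k$. Then $$R_{k,n}=(R_{1,0})^k\sum_{(P_1,\dots,P_k)}\prod_{i=1}^k w(P_i),$$ the sum running over all $k$-tuples of $T_{\mathbf M}$-lattice paths such that $P_i$ goes from $A_i$ to $E_i$ and no two of the paths share a vertex, where $w(P)$ is the product of the weights of the steps of $P$. (For $k=1$ this says $R_{1,n}/R_{1,0}$ is the weighted count of $T_{\mathbf M}$-lattice paths from $(0,0)$ to $(2n,0)$.)
   Context: Fix $r\ge1$, $I_r=\{1,\dots,r\}$, and let $(R_{\alpha,n})$ be the $A_r$ $Q$-system: $R_{0,n}=R_{r+1,n}=1$, $R_{\alpha,n+1}R_{\alpha,n-1}=R_{\alpha,n}^2+R_{\alpha+1,n}R_{\alpha-1,n}$ ($\alpha\in I_r$, $n\in\mathbb Z$), viewed as rational functions of $2r$ algebraically independent initial values. An ascending Motzkin path is $\mathbf M=(m_1,\dots,m_r)\in\mathbb Z^r$ with $m_{\alpha+1}-m_\alpha\in\{0,1\}$; here $m_1=0$. Its initial data are $R_{\alpha,m_\alpha},R_{\alpha,m_\alpha+1}$ ($\alpha\in I_r$). Weights: with $\lambda_{\alpha,n}=R_{\alpha,n+1}/R_{\alpha,n}$ and $\mu_{\alpha,n}=R_{\alpha,n}/R_{\alpha-1,n}$ (so $\lambda_{0,n}=\lambda_{r+1,n}=1$),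 and any value for $m_0,m_{r+1}$, set $y_{2\alpha-1}=\lambda_{\alpha,m_\alpha}/\lambda_{\alpha-1,m_{\alpha-1}}$ for $1\le\alpha\le r+1$ and $y_{2\alpha}=\mu_{\alpha+1,m_\alpha+1}/\mu_{\alpha,m_\alpha}$ for $1\le\alpha\le r$. The tree $T_{\mathbf M}$: let $H=\{\alpha\in\{2,\dots,r\}: m_\alpha=m_{\alpha-1}\}$, $s=|H|$, $N=2r+1-s$. It has $2r+1$ edges labelled $1,\dots,2r+1$; edge $2\alpha-1$ with $\alpha\in H$ is called horizontal, all others vertical. The $N$ vertical edges, in increasing order of label, form a path with vertices $v_0,v_1,\dots,v_N$ (the $k$-th vertical edge joins $v_{k-1}$ and $v_k$; $v_k$ has height $k$). For each $\alpha\in H$ the horizontal edge $2\alpha-1$ joins a new leaf vertex to the upper endpoint of edge $2\alpha-2$. Traversing edge $e$ toward $v_0$ (from $v_k$ to $v_{k-1}$, or from a leaf to the chain) has weight $y_e$; traversing it away from $v_0$ has weight $1$. $T_{\mathbf M}$-lattice paths: sequences of lattice points of $\mathbb Z^2$ with heights in $[0,N]$, using steps $(x,h)\to(x+1,h+1)$ (weight $1$, allowed if $h<N$), $(x,h)\to(x+1,h-1)$ (weight $y_e$ for the vertical edge $e$ joining $v_{h-1},v_h$), and $(x,h)\to(x+2,h)$ (allowed only if a horizontal edge $e$ is attached at $v_h$, weight $y_e$). The vertices of a path are the endpoints of its steps. *)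

theory Defs
  imports Main
begin

definition qsys :: "nat \<Rightarrow> (nat \<Rightarrow> int \<Rightarrow> 'a::field) \<Rightarrow> bool" where
  "qsys r R \<longleftrightarrow> (\<forall>n. R 0 n = 1 \<and> R (r+1) n = 1) \<and>
     (\<forall>\<alpha>\<in>{1..r}. \<forall>n. R \<alpha> (n+1) * R \<alpha> (n-1) = (R \<alpha> n)^2 + R (\<alpha>+1) n * R (\<alpha>-1) n)"

text \<open>Ascending Motzkin path (m 1, ..., m r) with m 1 = 0; values m 0, m (r+1) arbitrary.\<close>
definition asc_motzkin :: "nat \<Rightarrow> (nat \<Rightarrow> int) \<Rightarrow> bool" where
  "asc_motzkin r m \<longleftrightarrow> m 1 = 0 \<and> (\<forall>\<alpha>\<in>{1..<r}. m (\<alpha>+1) - m \<alpha> \<in> {0,1})"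

definition lam :: "(nat \<Rightarrow> int \<Rightarrow> 'a::field) \<Rightarrow> nat \<Rightarrow> int \<Rightarrow> 'a" where
  "lam R \<alpha> n = R \<alpha> (n+1) / R \<alpha> n"

definition mu :: "(nat \<Rightarrow> int \<Rightarrow> 'a::field) \<Rightarrow> nat \<Rightarrow> int \<Rightarrow> 'a" where
  "mu R \<alpha> n = R \<alpha> n / R (\<alpha>-1) n"

definition yw :: "(nat \<Rightarrow> int) \<Rightarrow> (nat \<Rightarrow> int \<Rightarrow> 'a::field) \<Rightarrow> nat \<Rightarrow> 'a" where
  "yw m R e = (if odd e then
       (let \<alpha> = (e+1) div 2 in lam R \<alpha> (m \<alpha>) / lam R (\<alpha>-1) (m (\<alpha>-1)))
     else (let \<alpha> = e div 2 in mu R (\<alpha>+1) (m \<alpha> + 1) / mu R \<alpha> (m \<alpha>)))"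

definition hset :: "nat \<Rightarrow> (nat \<Rightarrow> int) \<Rightarrow> nat set" where
  "hset r m = {\<alpha>\<in>{2..r}. m \<alpha> = m (\<alpha>-1)}"

definition vertical :: "nat \<Rightarrow> (nat \<Rightarrow> int) \<Rightarrow> nat \<Rightarrow> bool" where
  "vertical r m e \<longleftrightarrow> e \<in> {1..2*r+1} \<and> \<not> (odd e \<and> (e+1) div 2 \<in> hset r m)"

text \<open>Position of a vertical edge in increasing order of labels: the k-th vertical edge
  joins v_(k-1) and v_k.\<close>
definition vpos :: "nat \<Rightarrow> (nat \<Rightarrow> int) \<Rightarrow> nat \<Rightarrow> nat" where
  "vpos r m e = card {e'\<in>{1..e}. vertical r m e'}"

definition NN :: "nat \<Rightarrow> (nat \<Rightarrow> int) \<Rightarrow> nat" where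
  "NN r m = 2*r + 1 - card (hset r m)"

text \<open>Weight of a down step from height h (traversing the vertical edge joining v_(h-1), v_h).\<close>
definition down_wt :: "nat \<Rightarrow> (nat \<Rightarrow> int) \<Rightarrow> (nat \<Rightarrow> int \<Rightarrow> 'a::field) \<Rightarrow> int \<Rightarrow> 'a" where
  "down_wt r m R h = yw m R (THE e. vertical r m e \<and> int (vpos r m e) = h)"

text \<open>A horizontal edge 2 alpha - 1 is attached at the upper endpoint v_(vpos (2 alpha - 2)).\<close>
definition has_horiz :: "nat \<Rightarrow> (nat \<Rightarrow> int) \<Rightarrow> int \<Rightarrow> bool" where
  "has_horiz r m h \<longleftrightarrow> (\<exists>\<alpha>\<in>hset r m. int (vpos r m (2*\<alpha>-2)) = h)"

definition horiz_wt :: "nat \<Rightarrow> (nat \<Rightarrow> int) \<Rightarrow> (nat \<Rightarrow> int \<Rightarrow> 'a::field) \<Rightarrow> int \<Rightarrow> 'a" where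
  "horiz_wt r m R h = yw m R (2 * (THE \<alpha>. \<alpha> \<in> hset r m \<and> int (vpos r m (2*\<alpha>-2)) = h) - 1)"

definition step_ok :: "nat \<Rightarrow> (nat \<Rightarrow> int) \<Rightarrow> int \<times> int \<Rightarrow> int \<times> int \<Rightarrow> bool" where
  "step_ok r m p q \<longleftrightarrow>
     (fst q = fst p + 1 \<and> snd q = snd p + 1 \<and> snd p < int (NN r m)) \<or>
     (fst q = fst p + 1 \<and> snd q = snd p - 1 \<and> snd p \<ge> 1) \<or>
     (fst q = fst p + 2 \<and> snd q = snd p \<and> has_horiz r m (snd p))"

definition step_wt :: "nat \<Rightarrow> (nat \<Rightarrow> int) \<Rightarrow> (nat \<Rightarrow> int \<Rightarrow> 'a::field) \<Rightarrow> int \<times> int \<Rightarrow> int \<times> int \<Rightarrow> 'a" where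
  "step_wt r m R p q = (if snd q = snd p + 1 then 1
      else if snd q = snd p - 1 then down_wt r m R (snd p)
      else horiz_wt r m R (snd p))"

definition is_lpath :: "nat \<Rightarrow> (nat \<Rightarrow> int) \<Rightarrow> (int \<times> int) list \<Rightarrow> int \<times> int \<Rightarrow> int \<times> int \<Rightarrow> bool" where
  "is_lpath r m P A E \<longleftrightarrow> P \<noteq> [] \<and> hd P = A \<and> last P = E \<and>
     (\<forall>p\<in>set P. 0 \<le> snd p \<and> snd p \<le> int (NN r m)) \<and>
     (\<forall>i < length P - 1. step_ok r m (P!i) (P!(i+1)))"

definition path_wt :: "nat \<Rightarrow> (nat \<Rightarrow> int) \<Rightarrow> (nat \<Rightarrow> int \<Rightarrow> 'a::field) \<Rightarrow> (int \<times> int) list \<Rightarrow> 'a" where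
  "path_wt r m R P = (\<Prod>i < length P - 1. step_wt r m R (P!i) (P!(i+1)))"

end

theory Submission
  imports Defs "Jordan_Normal_Form.Determinant"
begin

text \<open>By the Q-system, \<open>R\<^sub>k\<^sub>,\<^sub>n\<close> is the \<open>k \<times> k\<close> Hankel determinant of the sequence \<open>R\<^sub>1\<^sub>,\<^sub>j\<close> centred at
  \<open>n\<close>, and ratios of the \<open>\<lambda>\<^sub>\<alpha>\<^sub>,\<^sub>n\<close> and \<open>\<mu>\<^sub>\<alpha>\<^sub>,\<^sub>n\<close> are the coefficients \<open>q\<^sub>\<alpha>\<close> and \<open>e\<^sub>\<alpha>\<close> of the
  quotient-difference scheme of that sequence. So even edges of the tree carry an \<open>e\<^sub>\<alpha>\<close>, vertical odd
  edges a \<open>q\<^sub>\<alpha>\<close>, and horizontal edges a difference of the two. The moments of the associated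
  orthogonal polynomials satisfy contiguity relations; with one moment sequence chosen for each vertex
  of the tree, these become exactly the recursion, by first steps, for the weighted count of lattice
  paths down to height \<open>0\<close>. This is the case \<open>k = 1\<close>. For general \<open>k\<close>, the Lindstrom-Gessel-Viennot
  lemma turns the Hankel determinant of path counts into a sum over disjoint families: by parity of
  \<open>x + h\<close>, crossing paths share a vertex even though horizontal steps skip an abscissa, so only the
  identity permutation survives.\<close>

section \<open>Weighted path sums\<close>

definition paths :: "('v \<Rightarrow> 'v \<Rightarrow> bool) \<Rightarrow> 'v \<Rightarrow> 'v \<Rightarrow> 'v list set" where
  "paths step a b = {P. P \<noteq> [] \<and> hd P = a \<and> last P = b \<and> successively step P}"

fun weight :: "('v \<Rightarrow> 'v \<Rightarrow> 'a::comm_monoid_mult) \<Rightarrow> 'v list \<Rightarrow> 'a" where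
  "weight w (p # q # P) = w p q * weight w (q # P)"
| "weight w _ = 1"

definition path_sum :: "('v \<Rightarrow> 'v \<Rightarrow> bool) \<Rightarrow> ('v \<Rightarrow> 'v \<Rightarrow> 'a::comm_semiring_1) \<Rightarrow> 'v \<Rightarrow> 'v \<Rightarrow> 'a" where
  "path_sum step w a b = (\<Sum>P\<in>paths step a b. weight w P)"

lemma weight_conv_prod: "weight w P = (\<Prod>i<length P - 1. w (P ! i) (P ! (i + 1)))"
  by (induction w P rule: weight.induct) (auto simp: prod.lessThan_Suc_shift simp del: prod.lessThan_Suc)

lemma weight_append: "weight w (P @ v # P') = weight w (P @ [v]) * weight w (v # P')"
  by (induction w P rule: weight.induct) (auto simp: mult.assoc)

locale ranked_steps =
  fixes step :: "'v \<Rightarrow> 'v \<Rightarrow> bool" and rank :: "'v \<Rightarrow> int"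
  assumes rank_step: "step p q \<Longrightarrow> rank p < rank q"
    and finite_step: "finite {q. step p q}"
begin

lemma distinct_path:
  assumes "P \<in> paths step a b" shows "distinct P"
proof -
  have "successively (\<lambda>p q. rank p < rank q) P"
    using assms rank_step by (auto simp: paths_def intro: successively_mono)
  then have "sorted_wrt (\<lambda>p q. rank p < rank q) P"
    by (subst (asm) successively_conv_sorted_wrt) (auto simp: transp_def)
  then show ?thesis by (induction P) auto
qed

lemma rank_le_if_path:
  assumes "P \<in> paths step a b" shows "rank a \<le> rank b"
  using assms
proof (induction P arbitrary: a)
  case (Cons p P)
  show ?case
  proof (cases "P = []")
    case False
    then have "P \<in> paths step (hd P) b" "step a (hd P)"
      using Cons.prems by (auto simp: paths_def successively_Cons)
    then show ?thesis using Cons.IH rank_step by force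
  qed (use Cons.prems in \<open>auto simp: paths_def\<close>)
qed (auto simp: paths_def)

lemma paths_eq_empty: "rank b < rank a \<Longrightarrow> paths step a b = {}"
  using rank_le_if_path by force

lemma paths_first_step:
  "paths step a b = (if a = b then {[a]} else {}) \<union> (\<Union>c\<in>{c. step a c}. (#) a ` paths step c b)"
  (is "_ = ?R")
proof (intro Set.set_eqI iffI)
  fix P assume P: "P \<in> paths step a b"
  then consider "P = [a]" | c P' where "P = a # c # P'"
    by (cases P rule: remdups_adj.cases) (auto simp: paths_def)
  then show "P \<in> ?R"
  proof cases
    case 2
    then have "step a c" "c # P' \<in> paths step c b" using P by (auto simp: paths_def)
    then show ?thesis using 2 by blast
  qed (use P in \<open>auto simp: paths_def\<close>)
qed (auto simp: paths_def successively_Cons split: if_splits)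

lemma finite_paths: "finite (paths step a b)"
proof (induction "nat (rank b - rank a + 1)" arbitrary: a rule: less_induct)
  case less
  show ?case
  proof (cases "rank b < rank a")
    case False
    have "finite (paths step c b)" if "step a c" for c
      using False rank_step[OF that] by (intro less) auto
    then show ?thesis by (subst paths_first_step) (use finite_step in auto)
  qed (simp add: paths_eq_empty)
qed

lemma path_sum_eq_0: "rank b < rank a \<Longrightarrow> path_sum step w a b = 0"
  by (simp add: path_sum_def paths_eq_empty)

lemma path_sum_first_step:
  "path_sum step w a b = (if a = b then 1 else 0) + (\<Sum>c | step a c. w a c * path_sum step w c b)"
proof -
  have extend: "(\<Sum>P\<in>(#) a ` paths step c b. weight w P) = w a c * path_sum step w c b" for c
  proof -
    have "(\<Sum>P\<in>(#) a ` paths step c b. weight w P) = (\<Sum>P\<in>paths step c b. weight w (a # P))"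
      by (simp add: sum.reindex)
    also have "\<dots> = (\<Sum>P\<in>paths step c b. w a c * weight w P)"
      by (rule sum.cong[OF refl]) (auto simp: paths_def neq_Nil_conv)
    finally show ?thesis by (simp add: path_sum_def sum_distrib_left)
  qed
  have "path_sum step w a b = (\<Sum>P\<in>(if a = b then {[a]} else {}). weight w P) +
      (\<Sum>P\<in>(\<Union>c\<in>{c. step a c}. (#) a ` paths step c b). weight w P)"
    unfolding path_sum_def
    by (subst paths_first_step, rule sum.union_disjoint)
      (use finite_paths finite_step in \<open>auto simp: paths_def\<close>)
  also have "(\<Sum>P\<in>(\<Union>c\<in>{c. step a c}. (#) a ` paths step c b). weight w P) =
      (\<Sum>c | step a c. \<Sum>P\<in>(#) a ` paths step c b. weight w P)"
    by (rule sum.UNION_disjoint) (use finite_paths finite_step in \<open>auto simp: paths_def\<close>)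
  finally show ?thesis by (simp add: extend)
qed

end

section \<open>The Lindstrom-Gessel-Viennot lemma\<close>

lemma (in comm_monoid_set) cong_except_pair:
  assumes "finite A" "i \<in> A" "j \<in> A" "i \<noteq> j"
    and "g i \<^bold>* g j = h i \<^bold>* h j" and "\<And>l. l \<in> A - {i, j} \<Longrightarrow> g l = h l"
  shows "F g A = F h A"
proof -
  have split: "F \<phi> A = \<phi> i \<^bold>* \<phi> j \<^bold>* F \<phi> (A - {i, j})" for \<phi>
    using assms(1-4) remove[of A i \<phi>] remove[of "A - {i}" j \<phi>]
    by (simp add: assoc Diff_insert[of A j "{i}", symmetric] insert_commute)
  have "F g (A - {i, j}) = F h (A - {i, j})"
    by (rule cong) (use assms(6) in auto)
  then show ?thesis unfolding split[of g] split[of h] by (simp add: assms(5))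
qed

lemma prod_sum_lists:
  fixes f :: "nat \<Rightarrow> 'b \<Rightarrow> 'a::comm_semiring_1"
  assumes "\<And>i. i < k \<Longrightarrow> finite (A i)"
  shows "(\<Prod>i<k. \<Sum>x\<in>A i. f i x)
    = (\<Sum>xs | length xs = k \<and> (\<forall>i<k. xs ! i \<in> A i). \<Prod>i<k. f i (xs ! i))"
proof -
  have "(\<Prod>i<k. \<Sum>x\<in>A i. f i x) = (\<Sum>g\<in>Pi\<^sub>E {..<k} A. \<Prod>i<k. f i (g i))"
    using assms by (intro prod_sum_PiE) auto
  also have "\<dots> = (\<Sum>xs | length xs = k \<and> (\<forall>i<k. xs ! i \<in> A i). \<Prod>i<k. f i (xs ! i))"
  proof (rule sum.reindex_bij_witness[of _ "\<lambda>xs. restrict ((!) xs) {..<k}" "\<lambda>g. map g [0..<k]"])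
    fix g assume "g \<in> Pi\<^sub>E {..<k} A"
    moreover have "restrict ((!) (map g [0..<k])) {..<k} = restrict g {..<k}"
      by (rule restrict_ext) simp
    ultimately show "restrict ((!) (map g [0..<k])) {..<k} = g"
      by simp
  next
    fix xs assume "xs \<in> {xs. length xs = k \<and> (\<forall>i<k. xs ! i \<in> A i)}"
    then show "map (restrict ((!) xs) {..<k}) [0..<k] = xs"
      by (intro nth_equalityI) auto
  qed auto
  finally show ?thesis .
qed

lemma finite_lists_nth:
  assumes "\<And>i. i < k \<Longrightarrow> finite (A i)"
  shows "finite {xs. length xs = k \<and> (\<forall>i<k. xs ! i \<in> A i)}"
proof (rule finite_subset)
  show "{xs. length xs = k \<and> (\<forall>i<k. xs ! i \<in> A i)} \<subseteq> {xs. set xs \<subseteq> (\<Union>i<k. A i) \<and> length xs = k}"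
  proof (intro subsetI CollectI conjI)
    fix xs x assume xs: "xs \<in> {xs. length xs = k \<and> (\<forall>i<k. xs ! i \<in> A i)}"
    show "length xs = k" using xs by simp
    assume "x \<in> set xs"
    then show "x \<in> (\<Union>i<k. A i)" using xs by (force simp: in_set_conv_nth)
  qed
  show "finite {xs. set xs \<subseteq> (\<Union>i<k. A i) \<and> length xs = k}"
    using assms by (intro finite_lists_length_eq) auto
qed

definition splice_at :: "'v \<Rightarrow> 'v list \<Rightarrow> 'v list \<Rightarrow> 'v list" where
  "splice_at v P P' = takeWhile (\<lambda>u. u \<noteq> v) P @ dropWhile (\<lambda>u. u \<noteq> v) P'"

lemma splice_at_append:
  assumes "v \<notin> set P1" "v \<notin> set P1'"
  shows "splice_at v (P1 @ v # P2) (P1' @ v # P2') = P1 @ v # P2'"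
  using assms by (auto simp: splice_at_def takeWhile_append dropWhile_append)

context
  fixes v :: 'v and P P' :: "'v list"
  assumes v: "v \<in> set P" "v \<in> set P'"
begin

lemma split_both:
  obtains P1 P2 P1' P2' where "P = P1 @ v # P2" "v \<notin> set P1" "P' = P1' @ v # P2'" "v \<notin> set P1'"
  using split_list_first[OF v(1)] split_list_first[OF v(2)] by blast

lemma splice_at_in_paths:
  assumes "P \<in> paths step a b" "P' \<in> paths step a' b'"
  shows "splice_at v P P' \<in> paths step a b'"
proof (rule split_both)
  fix P1 P2 P1' P2'
  assume "P = P1 @ v # P2" "v \<notin> set P1" "P' = P1' @ v # P2'" "v \<notin> set P1'"
  then show ?thesis
    using assms
    by (auto simp: splice_at_append paths_def successively_append_iff hd_append split: if_splits)
qed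

lemma in_set_splice_at: "v \<in> set (splice_at v P P')"
  by (rule split_both) (simp add: splice_at_append)

lemma weight_splice_at:
  "weight w (splice_at v P P') * weight w (splice_at v P' P) = weight w P * weight w P'"
proof (rule split_both)
  fix P1 P2 P1' P2'
  assume "P = P1 @ v # P2" "v \<notin> set P1" "P' = P1' @ v # P2'" "v \<notin> set P1'"
  then show ?thesis
    using weight_append[of w P1 v P2] weight_append[of w P1 v P2']
      weight_append[of w P1' v P2] weight_append[of w P1' v P2']
    by (simp add: splice_at_append mult_ac)
qed

lemma mset_splice_at: "mset (splice_at v P P') + mset (splice_at v P' P) = mset P + mset P'"
  by (rule split_both) (simp add: splice_at_append)

lemma splice_at_splice_at: "splice_at v (splice_at v P P') (splice_at v P' P) = P"
  by (rule split_both) (simp add: splice_at_append)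

end

definition path_families ::
  "('v \<Rightarrow> 'v \<Rightarrow> bool) \<Rightarrow> nat \<Rightarrow> (nat \<Rightarrow> 'v) \<Rightarrow> (nat \<Rightarrow> 'v) \<Rightarrow> 'v list list set" where
  "path_families step k a b = {Ps. length Ps = k \<and> (\<forall>i<k. Ps ! i \<in> paths step (a i) (b i))}"

definition vertex_disjoint :: "'v list list \<Rightarrow> bool" where
  "vertex_disjoint Ps \<longleftrightarrow>
    (\<forall>i<length Ps. \<forall>j<length Ps. i \<noteq> j \<longrightarrow> set (Ps ! i) \<inter> set (Ps ! j) = {})"

definition indices_through :: "'v \<Rightarrow> 'v list list \<Rightarrow> nat set" where
  "indices_through v Ps = {i. i < length Ps \<and> v \<in> set (Ps ! i)}"

definition swap_tails :: "'v \<Rightarrow> nat \<Rightarrow> nat \<Rightarrow> 'v list list \<Rightarrow> 'v list list" where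
  "swap_tails v i j Ps =
    Ps[i := splice_at v (Ps ! i) (Ps ! j), j := splice_at v (Ps ! j) (Ps ! i)]"

lemma length_swap_tails [simp]: "length (swap_tails v i j Ps) = length Ps"
  by (simp add: swap_tails_def)

lemma finite_indices_through: "finite (indices_through v Ps)"
  by (simp add: indices_through_def)

lemma mset_concat_conv_sum: "mset (concat Ps) = (\<Sum>i<length Ps. mset (Ps ! i))"
  by (simp add: mset_concat sum_list_sum_nth atLeast0LessThan)

lemma count_mset_concat:
  assumes "\<forall>P\<in>set Ps. distinct P"
  shows "count (mset (concat Ps)) v = card (indices_through v Ps)"
proof -
  have "count (mset (concat Ps)) v = (\<Sum>i<length Ps. if v \<in> set (Ps ! i) then 1 else 0)"
    unfolding mset_concat_conv_sum count_sum
    by (intro sum.cong refl) (use assms in \<open>auto simp: distinct_count_atmost_1\<close>)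
  then show ?thesis by (simp add: sum.If_cases indices_through_def Int_def lessThan_def)
qed

lemma vertex_disjoint_iff_count_le_1:
  assumes "\<forall>P\<in>set Ps. distinct P"
  shows "vertex_disjoint Ps \<longleftrightarrow> (\<forall>v. count (mset (concat Ps)) v \<le> 1)"
proof -
  have "card (indices_through v Ps) \<le> 1 \<longleftrightarrow> (\<forall>i\<in>indices_through v Ps. \<forall>j\<in>indices_through v Ps. i = j)" for v
    using card_le_Suc0_iff_eq[OF finite_indices_through] by simp
  then show ?thesis
    unfolding count_mset_concat[OF assms] vertex_disjoint_def indices_through_def by blast
qed

context
  fixes v :: 'v and i j :: nat and Ps :: "'v list list"
  assumes through: "i \<in> indices_through v Ps" "j \<in> indices_through v Ps" and ij: "i \<noteq> j"
begin

lemma nth_swap_tails: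
  assumes "l < length Ps"
  shows "swap_tails v i j Ps ! l =
    (if l = i then splice_at v (Ps ! i) (Ps ! j)
     else if l = j then splice_at v (Ps ! j) (Ps ! i) else Ps ! l)"
  using assms ij by (auto simp: swap_tails_def)

lemma swap_tails_in_path_families:
  assumes "Ps \<in> path_families step k a b"
  shows "swap_tails v i j Ps \<in> path_families step k a (b \<circ> transpose i j)"
  using assms through ij
  by (auto simp: path_families_def nth_swap_tails indices_through_def transpose_def
      intro!: splice_at_in_paths)

lemma prod_weight_swap_tails:
  "(\<Prod>l<length Ps. weight w (swap_tails v i j Ps ! l)) = (\<Prod>l<length Ps. weight w (Ps ! l))"
  by (rule prod.cong_except_pair[of _ i j])
    (use through ij in \<open>auto simp: nth_swap_tails indices_through_def weight_splice_at\<close>)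

lemma mset_concat_swap_tails: "mset (concat (swap_tails v i j Ps)) = mset (concat Ps)"
proof -
  have "(\<Sum>l<length Ps. mset (swap_tails v i j Ps ! l)) = (\<Sum>l<length Ps. mset (Ps ! l))"
    by (rule sum.cong_except_pair[of _ i j])
      (use through ij in \<open>auto simp: nth_swap_tails indices_through_def mset_splice_at\<close>)
  then show ?thesis by (simp add: mset_concat_conv_sum)
qed

lemma indices_through_swap_tails: "indices_through v (swap_tails v i j Ps) = indices_through v Ps"
proof -
  have "v \<in> set (swap_tails v i j Ps ! l) \<longleftrightarrow> v \<in> set (Ps ! l)" if "l < length Ps" for l
    using that through by (auto simp: nth_swap_tails indices_through_def in_set_splice_at)
  then show ?thesis by (auto simp: indices_through_def)
qed

lemma swap_tails_swap_tails: "swap_tails v i j (swap_tails v i j Ps) = Ps"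
proof (rule nth_equalityI)
  fix l assume "l < length (swap_tails v i j (swap_tails v i j Ps))"
  then show "swap_tails v i j (swap_tails v i j Ps) ! l = Ps ! l"
    using through ij
    by (auto simp: swap_tails_def nth_list_update indices_through_def splice_at_splice_at)
qed (simp add: swap_tails_def)

end

text \<open>Swapping tails at \<open>v\<close> changes neither the multiset of all vertices of the family nor the set of
  indices of paths through \<open>v\<close>; so an arbitrary but fixed choice of \<open>v\<close> from that multiset and of
  the two least indices makes the swap an involution.\<close>

definition crossing_site :: "'v list list \<Rightarrow> 'v \<times> nat \<times> nat" where
  "crossing_site Ps = (let v = SOME v. \<not> count (mset (concat Ps)) v \<le> 1;
     i = Min (indices_through v Ps);
     j = Min (indices_through v Ps - {i}) in (v, i, j))"

lemma crossing_site_indices_through: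
  assumes "\<forall>P\<in>set Ps. distinct P" "\<not> vertex_disjoint Ps" "crossing_site Ps = (v, i, j)"
  shows "i \<in> indices_through v Ps" "j \<in> indices_through v Ps" "i \<noteq> j"
proof -
  have v: "v = (SOME v. \<not> count (mset (concat Ps)) v \<le> 1)"
    and i: "i = Min (indices_through v Ps)" and j: "j = Min (indices_through v Ps - {i})"
    using assms(3) by (auto simp: crossing_site_def Let_def)
  have "\<exists>v. \<not> count (mset (concat Ps)) v \<le> 1"
    using assms(2) vertex_disjoint_iff_count_le_1[OF assms(1)] by blast
  then have "\<not> count (mset (concat Ps)) v \<le> 1" unfolding v by (rule someI_ex)
  then have two_paths: "\<not> card (indices_through v Ps) \<le> 1" using count_mset_concat[OF assms(1)] by simp
  show "i \<in> indices_through v Ps"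
    unfolding i by (intro Min_in finite_indices_through) (use two_paths in auto)
  have "indices_through v Ps - {i} \<noteq> {}"
  proof
    assume "indices_through v Ps - {i} = {}"
    then have "card (indices_through v Ps) \<le> card {i}" by (intro card_mono) auto
    with two_paths show False by simp
  qed
  then have "j \<in> indices_through v Ps - {i}"
    unfolding j by (intro Min_in) (auto simp: finite_indices_through)
  then show "j \<in> indices_through v Ps" "i \<noteq> j" by auto
qed

lemma crossing_site_swap_tails:
  assumes "\<forall>P\<in>set Ps. distinct P" "\<not> vertex_disjoint Ps" "crossing_site Ps = (v, i, j)"
  shows "crossing_site (swap_tails v i j Ps) = (v, i, j)"
proof -
  note site = crossing_site_indices_through[OF assms]
  show ?thesis
    using assms(3)
    by (auto simp: crossing_site_def Let_def mset_concat_swap_tails[OF site]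
        indices_through_swap_tails[OF site])
qed

definition permuted_families ::
  "('v \<Rightarrow> 'v \<Rightarrow> bool) \<Rightarrow> nat \<Rightarrow> (nat \<Rightarrow> 'v) \<Rightarrow> (nat \<Rightarrow> 'v) \<Rightarrow> ((nat \<Rightarrow> nat) \<times> 'v list list) set" where
  "permuted_families step k a b = (SIGMA \<sigma>:{\<sigma>. \<sigma> permutes {0..<k}}. path_families step k a (b \<circ> \<sigma>))"

definition signed_weight ::
  "('v \<Rightarrow> 'v \<Rightarrow> 'a::comm_ring_1) \<Rightarrow> (nat \<Rightarrow> nat) \<times> 'v list list \<Rightarrow> 'a" where
  "signed_weight w = (\<lambda>(\<sigma>, Ps). signof \<sigma> * (\<Prod>i<length Ps. weight w (Ps ! i)))"

definition tail_swap :: "(nat \<Rightarrow> nat) \<times> 'v list list \<Rightarrow> (nat \<Rightarrow> nat) \<times> 'v list list" where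
  "tail_swap = (\<lambda>(\<sigma>, Ps). let (v, i, j) = crossing_site Ps in (\<sigma> \<circ> transpose i j, swap_tails v i j Ps))"

context ranked_steps
begin

lemma distinct_in_path_families:
  assumes "Ps \<in> path_families step k a b" shows "\<forall>P\<in>set Ps. distinct P"
proof
  fix P assume "P \<in> set Ps"
  then obtain i where "i < k" "P = Ps ! i"
    using assms by (auto simp: path_families_def in_set_conv_nth)
  then have "P \<in> paths step (a i) (b i)" using assms by (simp add: path_families_def)
  then show "distinct P" by (rule distinct_path)
qed

lemma finite_path_families: "finite (path_families step k a b)"
  unfolding path_families_def by (rule finite_lists_nth) (rule finite_paths)

lemma finite_permuted_families: "finite (permuted_families step k a b)"
  by (simp add: permuted_families_def finite_permutations finite_path_families)

lemma tail_swap: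
  fixes w :: "'v \<Rightarrow> 'v \<Rightarrow> 'c::comm_ring_1"
  assumes x: "x \<in> permuted_families step k a b" and meet: "\<not> vertex_disjoint (snd x)"
  shows tail_swap_in_permuted_families: "tail_swap x \<in> permuted_families step k a b"
    and tail_swap_not_disjoint: "\<not> vertex_disjoint (snd (tail_swap x))"
    and tail_swap_tail_swap: "tail_swap (tail_swap x) = x"
    and sign_tail_swap: "sign (fst (tail_swap x)) = - sign (fst x)"
    and signed_weight_tail_swap: "signed_weight w (tail_swap x) = - signed_weight w x"
proof -
  obtain \<sigma> Ps where x_eq: "x = (\<sigma>, Ps)" by (cases x)
  obtain v i j where site: "crossing_site Ps = (v, i, j)" by (metis prod_cases3)
  have \<sigma>: "\<sigma> permutes {0..<k}" and Ps: "Ps \<in> path_families step k a (b \<circ> \<sigma>)"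
    and meet: "\<not> vertex_disjoint Ps"
    using x meet by (auto simp: x_eq permuted_families_def)
  note distinct = distinct_in_path_families[OF Ps]
  note through = crossing_site_indices_through[OF distinct meet site]
  have swap: "tail_swap (\<sigma>, Ps) = (\<sigma> \<circ> transpose i j, swap_tails v i j Ps)"
    by (simp add: tail_swap_def site)
  have Ps': "swap_tails v i j Ps \<in> path_families step k a (b \<circ> (\<sigma> \<circ> transpose i j))"
    using swap_tails_in_path_families[OF through Ps] by (simp add: comp_assoc)
  have ij: "i < k" "j < k" using through Ps by (auto simp: indices_through_def path_families_def)
  show "tail_swap x \<in> permuted_families step k a b"
    using Ps' permutes_compose[OF permutes_swap_id \<sigma>] ij by (simp add: x_eq swap permuted_families_def)
  show "\<not> vertex_disjoint (snd (tail_swap x))"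
    using meet vertex_disjoint_iff_count_le_1[OF distinct]
      vertex_disjoint_iff_count_le_1[OF distinct_in_path_families[OF Ps']]
    by (simp add: x_eq swap mset_concat_swap_tails[OF through])
  show "tail_swap (tail_swap x) = x"
    using crossing_site_swap_tails[OF distinct meet site] swap_tails_swap_tails[OF through]
    unfolding x_eq swap by (simp add: tail_swap_def comp_assoc)
  have "permutation \<sigma>" using \<sigma> permutation_permutes by blast
  then show sign: "sign (fst (tail_swap x)) = - sign (fst x)"
    using through(3) by (simp add: x_eq swap sign_compose permutation_swap_id sign_swap_id)
  show "signed_weight w (tail_swap x) = - signed_weight w x"
    using sign prod_weight_swap_tails[OF through, of w] by (simp add: signed_weight_def x_eq swap)
qed

lemma sum_signed_weight_meeting:
  fixes w :: "'v \<Rightarrow> 'v \<Rightarrow> 'c::comm_ring_1"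
  shows "(\<Sum>x | x \<in> permuted_families step k a b \<and> \<not> vertex_disjoint (snd x). signed_weight w x) = 0"
proof (rule sum_involution_eq_0[where h = tail_swap])
  fix x assume "x \<in> {x. x \<in> permuted_families step k a b \<and> \<not> vertex_disjoint (snd x)}"
  then have x: "x \<in> permuted_families step k a b" "\<not> vertex_disjoint (snd x)" by auto
  show "signed_weight w (tail_swap x) + signed_weight w x = 0"
    by (simp add: signed_weight_tail_swap[OF x])
  show "tail_swap x \<in> {x. x \<in> permuted_families step k a b \<and> \<not> vertex_disjoint (snd x)}"
    by (simp add: tail_swap_in_permuted_families[OF x] tail_swap_not_disjoint[OF x])
  show "tail_swap (tail_swap x) = x"
    by (rule tail_swap_tail_swap[OF x])
  show "tail_swap x \<noteq> x"
    using sign_tail_swap[OF x] by (auto simp: sign_def split: if_splits)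
qed

lemma det_path_sum:
  fixes w :: "'v \<Rightarrow> 'v \<Rightarrow> 'c::comm_ring_1"
  shows "det (mat k k (\<lambda>(i, j). path_sum step w (a i) (b j)))
    = (\<Sum>x\<in>permuted_families step k a b. signed_weight w x)"
proof -
  let ?A = "mat k k (\<lambda>(i, j). path_sum step w (a i) (b j))"
  have "det ?A = (\<Sum>\<sigma> | \<sigma> permutes {0..<k}. signof \<sigma> * (\<Prod>i<k. ?A $$ (i, \<sigma> i)))"
    unfolding atLeast0LessThan[of k, symmetric] by (rule det_def') simp
  also have "\<dots> = (\<Sum>\<sigma> | \<sigma> permutes {0..<k}. signof \<sigma> * (\<Prod>i<k. path_sum step w (a i) (b (\<sigma> i))))"
  proof (intro sum.cong refl arg_cong2[of _ _ _ _ "(*)"] prod.cong)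
    fix \<sigma> i assume "\<sigma> \<in> {\<sigma>. \<sigma> permutes {0..<k}}" "i \<in> {..<k}"
    then have "i < k" "\<sigma> i < k" using permutes_in_image[of \<sigma> "{0..<k}" i] by auto
    then show "?A $$ (i, \<sigma> i) = path_sum step w (a i) (b (\<sigma> i))" by simp
  qed
  also have "\<dots> = (\<Sum>\<sigma> | \<sigma> permutes {0..<k}. \<Sum>Ps\<in>path_families step k a (b \<circ> \<sigma>). signed_weight w (\<sigma>, Ps))"
    unfolding path_sum_def path_families_def
    by (subst prod_sum_lists) (simp_all add: finite_paths signed_weight_def sum_distrib_left)
  also have "\<dots> = (\<Sum>x\<in>permuted_families step k a b. signed_weight w x)"
    by (simp add: permuted_families_def sum.Sigma finite_permutations finite_path_families)
  finally show ?thesis .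
qed

theorem lindstrom_gessel_viennot:
  fixes w :: "'v \<Rightarrow> 'v \<Rightarrow> 'c::comm_ring_1"
  assumes compatible: "\<And>\<sigma> Ps. \<sigma> permutes {0..<k} \<Longrightarrow> Ps \<in> path_families step k a (b \<circ> \<sigma>) \<Longrightarrow>
      vertex_disjoint Ps \<Longrightarrow> \<sigma> = id"
  shows "det (mat k k (\<lambda>(i, j). path_sum step w (a i) (b j))) =
    (\<Sum>Ps | Ps \<in> path_families step k a b \<and> vertex_disjoint Ps. \<Prod>i<k. weight w (Ps ! i))"
proof -
  let ?F = "permuted_families step k a b"
  have "(\<Sum>x\<in>?F. signed_weight w x) = (\<Sum>x | x \<in> ?F \<and> vertex_disjoint (snd x). signed_weight w x)
      + (\<Sum>x | x \<in> ?F \<and> \<not> vertex_disjoint (snd x). signed_weight w x)"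
    by (subst sum.union_disjoint[symmetric]) (auto intro!: sum.cong simp: finite_permuted_families)
  also have "\<dots> = (\<Sum>x | x \<in> ?F \<and> vertex_disjoint (snd x). signed_weight w x)"
    by (simp add: sum_signed_weight_meeting)
  also have "\<dots> = (\<Sum>Ps | Ps \<in> path_families step k a b \<and> vertex_disjoint Ps. \<Prod>i<k. weight w (Ps ! i))"
  proof (rule sum.reindex_bij_witness[of _ "Pair id" snd])
    fix x assume "x \<in> {x \<in> ?F. vertex_disjoint (snd x)}"
    moreover from this have "fst x = id" using compatible by (auto simp: permuted_families_def)
    ultimately show "(id, snd x) = x" "snd x \<in> {Ps \<in> path_families step k a b. vertex_disjoint Ps}"
      "(\<Prod>i<k. weight w (snd x ! i)) = signed_weight w x"
      by (auto simp: permuted_families_def path_families_def signed_weight_def)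
  qed (auto simp: permuted_families_def)
  finally show ?thesis by (simp add: det_path_sum)
qed

end

section \<open>Quotient-difference schemes and Hankel determinants\<close>

lemma det_permute_rows_cols:
  assumes A: "A \<in> carrier_mat n n" and p: "p permutes {0..<n}"
  shows "det (mat n n (\<lambda>(i, j). A $$ (p i, p j))) = det A"
proof -
  define B where "B = mat n n (\<lambda>(i, j). A $$ (p i, j))"
  have B: "transpose_mat B \<in> carrier_mat n n" by (simp add: B_def)
  have "transpose_mat (mat n n (\<lambda>(i, j). A $$ (p i, p j))) = mat n n (\<lambda>(i, j). transpose_mat B $$ (p i, j))"
    using permutes_in_image[OF p] by (intro eq_matI) (auto simp: B_def)
  then have "det (mat n n (\<lambda>(i, j). A $$ (p i, p j))) = signof p * det (transpose_mat B)"
    using det_permute_rows[OF B p] by (metis det_transpose mat_carrier)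
  also have "det (transpose_mat B) = signof p * det A"
    using det_permute_rows[OF A p] det_transpose[of B n] by (simp add: B_def)
  also have "signof p * (signof p * det A) = det A"
    by (simp add: sign_def)
  finally show ?thesis .
qed

lemma det_reverse_rows_cols:
  "det (mat k k (\<lambda>(i, j). f (k - 1 - i) (k - 1 - j))) = det (mat k k (\<lambda>(i, j). f i j))"
proof -
  define p where "p i = (if i < k then k - 1 - i else i)" for i
  have "p permutes {0..<k}"
    by (intro bij_imp_permutes bij_betw_byWitness[where f' = p]) (auto simp: p_def)
  then have "det (mat k k (\<lambda>(i, j). mat k k (\<lambda>(i, j). f i j) $$ (p i, p j)))
      = det (mat k k (\<lambda>(i, j). f i j))"
    by (intro det_permute_rows_cols) auto
  moreover have "mat k k (\<lambda>(i, j). mat k k (\<lambda>(i, j). f i j) $$ (p i, p j))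
      = mat k k (\<lambda>(i, j). f (k - 1 - i) (k - 1 - j))"
    by (intro eq_matI) (auto simp: p_def)
  ultimately show ?thesis by simp
qed

text \<open>Rutishauser's rhombus rules; \<open>q k n\<close> and \<open>e k n\<close> stand for \<open>q\<^sub>k\<close> and \<open>e\<^sub>k\<close> with upper index \<open>n\<close>.\<close>

locale qd_scheme =
  fixes s :: "int \<Rightarrow> 'a::comm_ring_1" and q e :: "nat \<Rightarrow> int \<Rightarrow> 'a"
  assumes q_1: "q 1 n * s n = s (n + 1)"
    and e_0: "e 0 n = 0"
    and rhombus_sum: "q (Suc k) n + e (Suc k) n = q (Suc k) (n + 1) + e k (n + 1)"
    and rhombus_prod: "q (Suc (Suc k)) n * e (Suc k) n = q (Suc k) (n + 1) * e (Suc k) (n + 1)"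
begin

fun hadamard_poly :: "nat \<Rightarrow> int \<Rightarrow> 'a poly" where
  "hadamard_poly 0 n = 1"
| "hadamard_poly (Suc k) n = pCons 0 (hadamard_poly k (n + 1)) - smult (q (Suc k) n) (hadamard_poly k n)"

text \<open>The functional \<open>x\<^sup>i \<mapsto> s i\<close> evaluated at \<open>x\<^sup>j\<close> times the Hadamard polynomial.\<close>

definition moment :: "nat \<Rightarrow> int \<Rightarrow> int \<Rightarrow> 'a" where
  "moment k n j = (\<Sum>i\<le>k. coeff (hadamard_poly k n) i * s (j + int i))"

lemma coeff_hadamard_poly_eq_0: "k < i \<Longrightarrow> coeff (hadamard_poly k n) i = 0"
  by (induction k arbitrary: n i) (auto simp: coeff_pCons split: nat.split)

lemma coeff_hadamard_poly_top: "coeff (hadamard_poly k n) k = 1"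
  by (induction k arbitrary: n) (auto simp: coeff_hadamard_poly_eq_0)

lemma moment_0 [simp]: "moment 0 n j = s j"
  by (simp add: moment_def)

lemma moment_Suc: "moment (Suc k) n j = moment k (n + 1) (j + 1) - q (Suc k) n * moment k n j"
proof -
  have "(\<Sum>i\<le>Suc k. coeff (pCons 0 (hadamard_poly k (n + 1))) i * s (j + int i)) = moment k (n + 1) (j + 1)"
    by (simp only: sum.atMost_Suc_shift) (simp add: moment_def algebra_simps)
  moreover have "(\<Sum>i\<le>Suc k. coeff (smult (q (Suc k) n) (hadamard_poly k n)) i * s (j + int i))
      = q (Suc k) n * moment k n j"
    by (simp add: moment_def coeff_hadamard_poly_eq_0 sum_distrib_left mult.assoc)
  ultimately show ?thesis
    unfolding moment_def[of "Suc k"] hadamard_poly.simps coeff_diff left_diff_distrib sum_subtractf by simp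
qed

lemma moment_contiguous: "moment k n j = moment k (n + 1) j + e k n * moment (k - 1) (n + 1) j"
proof (induction k arbitrary: n j)
  case (Suc k)
  have previous: "e k (n + 1) * moment (k - 1) (n + 1 + 1) (j + 1)
      = e k (n + 1) * (moment k (n + 1) j + q k (n + 1) * moment (k - 1) (n + 1) j)"
    by (cases k) (simp_all add: e_0 moment_Suc)
  have prod: "q (Suc k) n * e k n = q k (n + 1) * e k (n + 1)"
    by (cases k) (simp_all add: e_0 rhombus_prod)
  have "moment (Suc k) n j - moment (Suc k) (n + 1) j
      = e k (n + 1) * moment (k - 1) (n + 1 + 1) (j + 1)
        - q (Suc k) n * (moment k (n + 1) j + e k n * moment (k - 1) (n + 1) j)
        + q (Suc k) (n + 1) * moment k (n + 1) j"
    using Suc.IH[of "n + 1" "j + 1"] Suc.IH[of n j] by (simp add: moment_Suc)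
  also have "\<dots> = (q (Suc k) (n + 1) + e k (n + 1) - q (Suc k) n) * moment k (n + 1) j
        + (q k (n + 1) * e k (n + 1) - q (Suc k) n * e k n) * moment (k - 1) (n + 1) j"
    unfolding previous by (simp add: algebra_simps)
  also have "\<dots> = e (Suc k) n * moment k (n + 1) j"
    by (simp add: prod rhombus_sum[symmetric])
  finally show ?case by (simp add: algebra_simps)
qed (simp add: e_0)

lemma moment_Suc_backward:
  "moment k (n + 1) (j + 1)
    = moment (Suc k) (n - 1) j + (q (Suc k) n - e (Suc k) (n - 1)) * moment k n j"
  using moment_contiguous[of "Suc k" "n - 1" j] by (simp add: moment_Suc[of k n] algebra_simps)

lemma moment_eq_0: "n \<le> j \<Longrightarrow> j < n + int k \<Longrightarrow> moment k n j = 0"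
proof (induction k arbitrary: n j)
  case (Suc k)
  have below: "moment (Suc k) n' j = 0" if "n' \<le> j" "j < n' + int k" for n'
    using that Suc.IH[of "n' + 1" "j + 1"] Suc.IH[of n' j] by (simp add: moment_Suc)
  show ?case
  proof (cases "j < n + int k")
    case False
    then have j: "j = n + int k" using Suc.prems by simp
    show ?thesis
    proof (cases "k = 0")
      case True
      then show ?thesis using q_1[of n] j by (simp add: moment_Suc)
    next
      case False
      then have "moment (Suc k) (n + 1) j = 0" "moment k (n + 1) j = 0"
        using below[of "n + 1"] Suc.IH[of "n + 1" j] j by simp_all
      then show ?thesis by (subst moment_contiguous) simp
    qed
  qed (use below Suc.prems in simp)
qed simp

lemma moment_diagonal_Suc:
  "moment (Suc k) n (n + int (Suc k)) = e (Suc k) n * moment k (n + 1) (n + 1 + int k)"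
  by (subst moment_contiguous) (simp add: moment_eq_0 algebra_simps)

lemma moment_eq_0_if_terminating:
  assumes "\<And>n. e (Suc k) n = 0"
  shows "moment (Suc k) n j = 0"
proof -
  have step: "moment (Suc k) n j = moment (Suc k) (n + 1) j" for n
    by (subst moment_contiguous) (simp add: assms)
  have "moment (Suc k) n j = moment (Suc k) j j"
  proof (induction n rule: int_induct[where k = j])
    case (step2 i) then show ?case using step[of "i - 1"] by simp
  qed (use step in auto)
  then show ?thesis by (simp add: moment_eq_0)
qed

text \<open>Multiplying the Hankel matrix by the unitriangular matrix of coefficients of the Hadamard
  polynomials makes it upper triangular.\<close>

theorem hankel_det:
  "det (mat k k (\<lambda>(i, j). s (n + int i + int j))) = (\<Prod>i<k. moment i n (n + int i))"
proof -
  define H where "H = mat k k (\<lambda>(i, j). s (n + int i + int j))"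
  define L where "L = mat k k (\<lambda>(i, j). coeff (hadamard_poly i n) j)"
  define U where "U = mat k k (\<lambda>(i, j). moment i n (n + int j))"
  have carrier: "H \<in> carrier_mat k k" "L \<in> carrier_mat k k" "U \<in> carrier_mat k k"
    by (auto simp: H_def L_def U_def)
  have "L * H = U"
  proof (rule eq_matI)
    fix i j assume "i < dim_row U" "j < dim_col U"
    then have ij: "i < k" "j < k" by (auto simp: U_def)
    have "(L * H) $$ (i, j) = (\<Sum>l<k. coeff (hadamard_poly i n) l * s (n + int l + int j))"
      using ij by (simp add: L_def H_def scalar_prod_def atLeast0LessThan)
    also have "\<dots> = moment i n (n + int j)"
      unfolding moment_def using ij
      by (intro sum.mono_neutral_cong_right) (auto simp: coeff_hadamard_poly_eq_0 algebra_simps)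
    finally show "(L * H) $$ (i, j) = U $$ (i, j)" using ij by (simp add: U_def)
  qed (use carrier in auto)
  then have "det U = det L * det H" using det_mult[OF carrier(2,1)] by simp
  moreover have "det L = prod_list (diag_mat L)"
    using carrier(2) by (intro det_lower_triangular[of k]) (auto simp: L_def coeff_hadamard_poly_eq_0)
  moreover have "det U = prod_list (diag_mat U)"
    using carrier(3) by (intro det_upper_triangular[of _ k]) (auto simp: U_def moment_eq_0)
  ultimately show ?thesis
    using carrier
    by (simp add: prod_list_diag_prod atLeast0LessThan coeff_hadamard_poly_top L_def U_def
        flip: H_def)
qed

end

section \<open>The quotient-difference scheme of a Q-system\<close>

locale nonvanishing_qsys =
  fixes r :: nat and R :: "nat \<Rightarrow> int \<Rightarrow> 'a::field"
  assumes qsys: "qsys r R"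
    and nonzero: "\<alpha> \<in> {1..r} \<Longrightarrow> R \<alpha> j \<noteq> 0"
begin

text \<open>Nothing is known about \<open>R \<alpha>\<close> for \<open>\<alpha> > r + 1\<close>. After extension by \<open>0\<close>, and because \<open>x / 0 = 0\<close>, the
  rhombus rules hold for all indices.\<close>

definition Q :: "nat \<Rightarrow> int \<Rightarrow> 'a" where
  "Q \<alpha> n = (if \<alpha> \<le> r + 1 then R \<alpha> n else 0)"

lemma Q_0 [simp]: "Q 0 n = 1"
  using qsys by (simp add: Q_def qsys_def)

lemma Q_Suc_r [simp]: "Q (Suc r) n = 1"
  using qsys by (simp add: Q_def qsys_def)

lemma Q_eq_0: "Suc r < \<alpha> \<Longrightarrow> Q \<alpha> n = 0"
  by (simp add: Q_def)

lemma Q_eq_R: "\<alpha> \<le> Suc r \<Longrightarrow> Q \<alpha> n = R \<alpha> n"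
  by (simp add: Q_def)

lemma Q_nonzero:
  assumes "\<alpha> \<le> Suc r" shows "Q \<alpha> n \<noteq> 0"
proof -
  consider "\<alpha> = 0" | "\<alpha> = Suc r" | "\<alpha> \<in> {1..r}" using assms by fastforce
  then show ?thesis by cases (auto simp: nonzero Q_eq_R[of \<alpha>])
qed

lemma Q_relation:
  assumes "\<alpha> \<le> r"
  shows "Q (Suc \<alpha>) (n + 1) * Q (Suc \<alpha>) (n - 1) = (Q (Suc \<alpha>) n)\<^sup>2 + Q (Suc (Suc \<alpha>)) n * Q \<alpha> n"
proof (cases "\<alpha> = r")
  case False
  then have "Suc \<alpha> \<in> {1..r}" using assms by auto
  with qsys have "R (Suc \<alpha>) (n + 1) * R (Suc \<alpha>) (n - 1) = (R (Suc \<alpha>) n)\<^sup>2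
      + R (Suc \<alpha> + 1) n * R (Suc \<alpha> - 1) n"
    unfolding qsys_def by blast
  with False assms show ?thesis by (simp add: Q_eq_R)
qed (simp add: Q_eq_0)

definition qd_q :: "nat \<Rightarrow> int \<Rightarrow> 'a" where
  "qd_q k n = lam Q k (n + int k - 1) / lam Q (k - 1) (n + int k - 2)"

definition qd_e :: "nat \<Rightarrow> int \<Rightarrow> 'a" where
  "qd_e k n = (if k = 0 then 0 else mu Q (k + 1) (n + int k) / mu Q k (n + int k - 1))"

lemma qd_q_Suc: "qd_q (Suc k) n = lam Q (Suc k) (n + int k) / lam Q k (n + int k - 1)"
  by (simp add: qd_q_def algebra_simps)

lemma qd_e_Suc: "qd_e (Suc k) n = mu Q (Suc (Suc k)) (n + int k + 1) / mu Q (Suc k) (n + int k)"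
  by (simp add: qd_e_def algebra_simps)

lemma qd_e_eq_0: "r < k \<Longrightarrow> qd_e k n = 0"
  by (simp add: qd_e_def mu_def Q_eq_0)

lemma qd_q_eq_0: "Suc r < k \<Longrightarrow> qd_q k n = 0"
  by (simp add: qd_q_def lam_def Q_eq_0)

lemma qd_q_minus_e_same_level:
  assumes "k \<le> r"
  shows "qd_q (Suc k) (n + 1) - qd_e (Suc k) n = lam Q (Suc k) (n + int k) / lam Q k (n + int k)"
proof -
  define c where "c = n + int k"
  have Q_nz: "Q k i \<noteq> 0" "Q (Suc k) i \<noteq> 0" for i using assms by (auto simp: Q_nonzero)
  have "qd_q (Suc k) (n + 1) - qd_e (Suc k) n
      = Q k c * (Q (Suc k) (c + 2) * Q (Suc k) c - Q (Suc (Suc k)) (c + 1) * Q k (c + 1))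
        / (Q k (c + 1) * Q (Suc k) c * Q (Suc k) (c + 1))"
    using Q_nz by (simp add: qd_q_Suc qd_e_Suc lam_def mu_def c_def field_simps)
  also have "\<dots> = Q k c * (Q (Suc k) (c + 1))\<^sup>2 / (Q k (c + 1) * Q (Suc k) c * Q (Suc k) (c + 1))"
    using Q_relation[OF assms, of "c + 1"] by (simp add: add.assoc)
  also have "\<dots> = lam Q (Suc k) c / lam Q k c"
    using Q_nz by (simp add: lam_def power2_eq_square mult.commute)
  finally show ?thesis by (simp add: c_def)
qed

lemma qd_q_minus_e_lower_level:
  assumes "k \<le> r"
  shows "qd_q (Suc k) n - qd_e k (n + 1) = lam Q (Suc k) (n + int k) / lam Q k (n + int k)"
proof (cases k)
  case 0
  then show ?thesis by (simp add: qd_q_Suc qd_e_def lam_def)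
next
  case (Suc l)
  define c where "c = n + int k"
  have Q_nz: "Q l i \<noteq> 0" "Q k i \<noteq> 0" "Q (Suc k) i \<noteq> 0" for i
    using assms Suc by (auto simp: Q_nonzero)
  have "qd_q (Suc k) n - qd_e k (n + 1)
      = Q (Suc k) (c + 1) * (Q k (c + 1) * Q k (c - 1) - Q (Suc k) c * Q l c)
        / (Q (Suc k) c * Q k c * Q k (c + 1))"
    using Q_nz by (simp add: qd_q_Suc qd_e_def lam_def mu_def c_def Suc field_simps)
  also have "\<dots> = Q (Suc k) (c + 1) * (Q k c)\<^sup>2 / (Q (Suc k) c * Q k c * Q k (c + 1))"
    using Q_relation[of l c] assms Suc by simp
  also have "\<dots> = lam Q (Suc k) c / lam Q k c"
    using Q_nz by (simp add: lam_def power2_eq_square mult.commute)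
  finally show ?thesis by (simp add: c_def)
qed

sublocale qd_scheme "Q (Suc 0)" qd_q qd_e
proof
  show "qd_q 1 n * Q (Suc 0) n = Q (Suc 0) (n + 1)" for n
    using Q_nonzero[of "Suc 0" n] by (simp add: qd_q_def lam_def)
  show "qd_e 0 n = 0" for n
    by (simp add: qd_e_def)
  show "qd_q (Suc k) n + qd_e (Suc k) n = qd_q (Suc k) (n + 1) + qd_e k (n + 1)" for k n
  proof (cases "k \<le> r")
    case True
    then show ?thesis
      using qd_q_minus_e_same_level[OF True, of n] qd_q_minus_e_lower_level[OF True, of n]
      by (simp add: algebra_simps)
  qed (simp add: qd_q_eq_0 qd_e_eq_0)
  show "qd_q (Suc (Suc k)) n * qd_e (Suc k) n = qd_q (Suc k) (n + 1) * qd_e (Suc k) (n + 1)" for k n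
  proof (cases "k < r")
    case True
    then have "Q k i \<noteq> 0" "Q (Suc k) i \<noteq> 0" "Q (Suc (Suc k)) i \<noteq> 0" for i
      by (auto simp: Q_nonzero)
    then show ?thesis
      by (simp add: qd_q_Suc qd_e_Suc lam_def mu_def field_simps)
  qed (simp add: qd_e_eq_0)
qed

lemma moment_diagonal:
  assumes "k \<le> r"
  shows "moment k n (n + int k) = Q (Suc k) (n + int k) / Q k (n + int k - 1)"
  using assms
proof (induction k arbitrary: n)
  case (Suc k)
  have "Q k i \<noteq> 0" "Q (Suc k) i \<noteq> 0" "Q (Suc (Suc k)) i \<noteq> 0" for i
    using Suc.prems by (auto simp: Q_nonzero)
  then show ?case
    using Suc.IH[of "n + 1"] Suc.prems unfolding moment_diagonal_Suc
    by (simp add: qd_e_Suc mu_def field_simps)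
qed simp

lemma moment_top: "moment (Suc r) n j = 0"
  by (intro moment_eq_0_if_terminating) (simp add: qd_e_eq_0)

theorem hankel_det_Q:
  assumes "k \<le> Suc r"
  shows "det (mat k k (\<lambda>(i, j). Q (Suc 0) (n + int i + int j))) = Q k (n + int k - 1)"
proof -
  have "l \<le> Suc r \<Longrightarrow> (\<Prod>i<l. moment i n (n + int i)) = Q l (n + int l - 1)" for l
    by (induction l) (auto simp: moment_diagonal Q_nonzero)
  then show ?thesis using assms by (simp add: hankel_det)
qed

end

section \<open>The tree of an ascending Motzkin path\<close>

definition horizontal :: "nat \<Rightarrow> (nat \<Rightarrow> int) \<Rightarrow> nat \<Rightarrow> bool" where
  "horizontal r m e \<longleftrightarrow> odd e \<and> (e + 1) div 2 \<in> hset r m"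

text \<open>The trunk edge \<open>e\<close> stands for the upper endpoint of \<open>e\<close>, and \<open>0\<close> for the root \<open>v\<^sub>0\<close>.\<close>

definition trunk :: "nat \<Rightarrow> (nat \<Rightarrow> int) \<Rightarrow> nat set" where
  "trunk r m = insert 0 {e. vertical r m e}"

definition next_trunk :: "nat \<Rightarrow> (nat \<Rightarrow> int) \<Rightarrow> nat \<Rightarrow> nat" where
  "next_trunk r m e = (if horizontal r m (Suc e) then Suc (Suc e) else Suc e)"

definition shift :: "nat \<Rightarrow> (nat \<Rightarrow> int) \<Rightarrow> nat \<Rightarrow> int" where
  "shift r m \<alpha> = - int (card {\<beta> \<in> hset r m. \<beta> \<le> \<alpha>})"

lemma hset_subset: "hset r m \<subseteq> {2..r}"
  by (auto simp: hset_def)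

lemma finite_hset: "finite (hset r m)"
  using hset_subset finite_subset by blast

lemma horizontal_odd: "horizontal r m (Suc (2 * \<alpha>)) \<longleftrightarrow> Suc \<alpha> \<in> hset r m"
  by (simp add: horizontal_def)

lemma not_horizontal_even: "\<not> horizontal r m (2 * \<alpha>)"
  by (simp add: horizontal_def)

lemma vertical_iff: "vertical r m e \<longleftrightarrow> 1 \<le> e \<and> e \<le> Suc (2 * r) \<and> \<not> horizontal r m e"
  by (auto simp: vertical_def horizontal_def)

lemma trunk_iff: "e \<in> trunk r m \<longleftrightarrow> e \<le> Suc (2 * r) \<and> \<not> horizontal r m e"
  by (cases "e = 0") (auto simp: trunk_def vertical_iff horizontal_def)

lemma horizontal_SucE:
  assumes "horizontal r m (Suc e)"
  obtains \<alpha> where "e = 2 * \<alpha>" "1 \<le> \<alpha>" "\<alpha> < r" "Suc \<alpha> \<in> hset r m"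
proof -
  obtain \<alpha> where \<alpha>: "e = 2 * \<alpha>" using assms by (auto simp: horizontal_def elim: oddE)
  moreover from this have "Suc \<alpha> \<in> hset r m" using assms by (simp add: horizontal_odd)
  ultimately show thesis using that[of \<alpha>] hset_subset[of r m] by force
qed

lemma shift_0: "shift r m 0 = 0"
  using hset_subset[of r m] by (auto simp: shift_def)

lemma shift_Suc: "shift r m (Suc \<alpha>) = shift r m \<alpha> - (if Suc \<alpha> \<in> hset r m then 1 else 0)"
proof -
  have "{\<beta> \<in> hset r m. \<beta> \<le> Suc \<alpha>}
      = (if Suc \<alpha> \<in> hset r m then insert (Suc \<alpha>) {\<beta> \<in> hset r m. \<beta> \<le> \<alpha>} else {\<beta> \<in> hset r m. \<beta> \<le> \<alpha>})"
    by (auto simp: le_Suc_eq)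
  then show ?thesis by (simp add: shift_def finite_hset)
qed

lemma shift_nonpos: "shift r m \<alpha> \<le> 0"
  by (simp add: shift_def)

lemma shift_gt: "1 \<le> \<alpha> \<Longrightarrow> - int \<alpha> < shift r m \<alpha>"
proof (induction \<alpha> rule: nat_induct_at_least)
  case base
  have "Suc 0 \<notin> hset r m" using hset_subset[of r m] by auto
  then show ?case by (simp add: shift_Suc shift_0)
qed (simp add: shift_Suc)

lemma vpos_Suc: "vpos r m (Suc e) = vpos r m e + (if vertical r m (Suc e) then 1 else 0)"
proof -
  have "{e' \<in> {1..Suc e}. vertical r m e'} =
    (if vertical r m (Suc e) then insert (Suc e) {e' \<in> {1..e}. vertical r m e'}
     else {e' \<in> {1..e}. vertical r m e'})"
    by (auto simp: le_Suc_eq)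
  then show ?thesis by (simp add: vpos_def)
qed

lemma vpos_0 [simp]: "vpos r m 0 = 0"
  by (simp add: vpos_def)

lemma vpos_1: "vpos r m (Suc 0) = 1"
  by (simp add: vpos_Suc vertical_def hset_def)

lemma vpos_conv_shift:
  assumes "e \<le> Suc (2 * r)"
  shows "int (vpos r m e) = int e + shift r m ((e + 1) div 2)"
  using assms
proof (induction e)
  case (Suc e)
  show ?case
  proof (cases "even e")
    case True
    then obtain \<alpha> where "e = 2 * \<alpha>" by blast
    then show ?thesis
      using Suc by (simp add: vpos_Suc vertical_iff horizontal_odd shift_Suc)
  next
    case False
    then have "vertical r m (Suc e)" "(Suc e + 1) div 2 = (e + 1) div 2"
      using Suc.prems by (auto simp: vertical_iff horizontal_def)
    then show ?thesis using Suc by (simp add: vpos_Suc)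
  qed
qed (simp add: shift_0)

lemma vpos_mono: "e \<le> e' \<Longrightarrow> vpos r m e \<le> vpos r m e'"
  by (induction e' rule: dec_induct) (auto simp: vpos_Suc)

lemma vpos_strict_mono:
  assumes "e < e'" "e' \<in> trunk r m" shows "vpos r m e < vpos r m e'"
proof -
  obtain e'' where "e' = Suc e''" "e \<le> e''" using assms by (cases e') auto
  then show ?thesis using assms vpos_mono[of e e'' r m] by (simp add: vpos_Suc trunk_def)
qed

lemma inj_on_vpos: "inj_on (vpos r m) (trunk r m)"
  by (rule linorder_inj_onI) (auto dest: vpos_strict_mono)

lemma trunk_representative:
  assumes "e \<le> Suc (2 * r)" "e \<notin> trunk r m"
  obtains e' where "e = Suc e'" "e' \<in> trunk r m" "horizontal r m (Suc e')" "vpos r m e = vpos r m e'"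
proof -
  have horiz: "horizontal r m e" using assms by (simp add: trunk_iff)
  then obtain e' where e': "e = Suc e'" by (cases e) (auto simp: horizontal_def)
  then have "\<not> horizontal r m e'" "\<not> vertical r m e"
    using horiz by (auto simp: horizontal_def vertical_iff)
  then show thesis using that[OF e'] assms(1) horiz e' by (simp add: trunk_iff vpos_Suc)
qed

lemma NN_eq_vpos: "NN r m = vpos r m (Suc (2 * r))"
proof -
  have "{\<beta> \<in> hset r m. \<beta> \<le> Suc r} = hset r m" using hset_subset[of r m] by auto
  moreover have "card (hset r m) \<le> r" using card_mono[OF _ hset_subset[of r m]] by simp
  ultimately have "int (vpos r m (Suc (2 * r))) = int (NN r m)"
    using vpos_conv_shift[of "Suc (2 * r)" r m] by (simp add: shift_def NN_def)
  then show ?thesis by simp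
qed

lemma vpos_le_NN: "e \<le> Suc (2 * r) \<Longrightarrow> vpos r m e \<le> NN r m"
  by (simp add: NN_eq_vpos vpos_mono)

lemma vpos_less_NN_iff:
  assumes "e \<le> Suc (2 * r)" shows "vpos r m e < NN r m \<longleftrightarrow> e \<le> 2 * r"
proof (cases "e = Suc (2 * r)")
  case False
  have "Suc (2 * r) \<in> trunk r m" using hset_subset[of r m] by (auto simp: trunk_iff horizontal_odd)
  then show ?thesis using False assms vpos_strict_mono[of e "Suc (2 * r)"] by (simp add: NN_eq_vpos)
qed (simp add: NN_eq_vpos)

lemma vpos_pos_iff: "0 < vpos r m e \<longleftrightarrow> 0 < e"
  using vpos_mono[of 1 e r m] by (cases "e = 0") (auto simp: vpos_1)

lemma vpos_next_trunk:
  assumes "e \<le> 2 * r"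
  shows "next_trunk r m e \<le> Suc (2 * r)" "vpos r m (next_trunk r m e) = vpos r m e + 1"
proof -
  have "next_trunk r m e \<le> Suc (2 * r) \<and> vpos r m (next_trunk r m e) = vpos r m e + 1"
  proof (cases "horizontal r m (Suc e)")
    case True
    then obtain \<alpha> where "e = 2 * \<alpha>" "\<alpha> < r" by (rule horizontal_SucE)
    then show ?thesis
      using True not_horizontal_even[of r m "Suc \<alpha>"] by (simp add: next_trunk_def vpos_Suc vertical_iff)
  qed (use assms in \<open>simp add: next_trunk_def vpos_Suc vertical_iff\<close>)
  then show "next_trunk r m e \<le> Suc (2 * r)" "vpos r m (next_trunk r m e) = vpos r m e + 1" by auto
qed

lemma vpos_pred:
  assumes "e \<in> trunk r m" "0 < e" shows "vpos r m e = vpos r m (e - 1) + 1"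
  using assms vpos_Suc[of r m "e - 1"] by (simp add: trunk_def)

lemma down_wt_vpos:
  assumes "e \<in> trunk r m" "0 < e" shows "down_wt r m R (int (vpos r m e)) = yw m R e"
proof -
  have "(THE e'. vertical r m e' \<and> int (vpos r m e') = int (vpos r m e)) = e"
    using assms inj_on_vpos[of r m] by (intro the_equality) (auto simp: trunk_def inj_on_def)
  then show ?thesis by (simp add: down_wt_def)
qed

lemma horizontal_attached_iff:
  assumes "e \<in> trunk r m"
  shows "\<alpha> \<in> hset r m \<and> int (vpos r m (2 * \<alpha> - 2)) = int (vpos r m e)
    \<longleftrightarrow> horizontal r m (Suc e) \<and> \<alpha> = Suc (e div 2)"
proof
  assume attached: "\<alpha> \<in> hset r m \<and> int (vpos r m (2 * \<alpha> - 2)) = int (vpos r m e)"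
  then have "2 \<le> \<alpha>" "\<alpha> \<le> r" using hset_subset[of r m] by auto
  then obtain \<beta> where \<beta>: "\<alpha> = Suc \<beta>" "\<beta> \<le> r" by (cases \<alpha>) auto
  then have "2 * \<beta> \<in> trunk r m" by (simp add: trunk_iff not_horizontal_even)
  then have "2 * \<beta> = e" using attached \<beta> assms inj_on_vpos[of r m] by (simp add: inj_on_def)
  then show "horizontal r m (Suc e) \<and> \<alpha> = Suc (e div 2)"
    using attached \<beta> horizontal_odd by auto
qed (auto elim!: horizontal_SucE)

lemma has_horiz_vpos:
  "e \<in> trunk r m \<Longrightarrow> has_horiz r m (int (vpos r m e)) \<longleftrightarrow> horizontal r m (Suc e)"
  unfolding has_horiz_def using horizontal_attached_iff by blast

lemma horiz_wt_vpos:
  assumes "e \<in> trunk r m" "horizontal r m (Suc e)"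
  shows "horiz_wt r m R (int (vpos r m e)) = yw m R (Suc e)"
proof -
  have "even e" using assms(2) by (simp add: horizontal_def)
  then show ?thesis
    unfolding horiz_wt_def horizontal_attached_iff[OF assms(1)] by (simp add: assms(2))
qed

definition strip_step :: "nat \<Rightarrow> (nat \<Rightarrow> int) \<Rightarrow> int \<times> int \<Rightarrow> int \<times> int \<Rightarrow> bool" where
  "strip_step r m p q \<longleftrightarrow> snd p \<in> {0..int (NN r m)} \<and> snd q \<in> {0..int (NN r m)} \<and> step_ok r m p q"

interpretation strip: ranked_steps "strip_step r m" fst for r m
proof
  show "fst p < fst q" if "strip_step r m p q" for p q
    using that by (auto simp: strip_step_def step_ok_def)
  show "finite {q. strip_step r m p q}" for p
    by (rule finite_subset[of _ "{(fst p + 1, snd p + 1), (fst p + 1, snd p - 1), (fst p + 2, snd p)}"])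
      (auto simp: strip_step_def step_ok_def)
qed

abbreviation strip_sum :: "nat \<Rightarrow> (nat \<Rightarrow> int) \<Rightarrow> (nat \<Rightarrow> int \<Rightarrow> 'a::field) \<Rightarrow> int \<times> int \<Rightarrow> int \<times> int \<Rightarrow> 'a" where
  "strip_sum r m R \<equiv> path_sum (strip_step r m) (step_wt r m R)"

lemma strip_sum_first_step:
  assumes "0 \<le> h" "h \<le> int (NN r m)"
  shows "strip_sum r m R (x, h) E = (if (x, h) = E then 1 else 0)
    + (if h < int (NN r m) then strip_sum r m R (x + 1, h + 1) E else 0)
    + (if 0 < h then down_wt r m R h * strip_sum r m R (x + 1, h - 1) E else 0)
    + (if has_horiz r m h then horiz_wt r m R h * strip_sum r m R (x + 2, h) E else 0)"
proof -
  have "{q. strip_step r m (x, h) q} = (if h < int (NN r m) then {(x + 1, h + 1)} else {}) \<union>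
      (if 0 < h then {(x + 1, h - 1)} else {}) \<union> (if has_horiz r m h then {(x + 2, h)} else {})"
    using assms by (auto simp: strip_step_def step_ok_def)
  then show ?thesis
    by (subst strip.path_sum_first_step) (auto simp: step_wt_def)
qed

lemma strip_sum_trunk_first_step:
  assumes e: "e \<in> trunk r m"
  shows "strip_sum r m R (x, int (vpos r m e)) (X, 0) = (if x = X \<and> e = 0 then 1 else 0)
    + (if e \<le> 2 * r then strip_sum r m R (x + 1, int (vpos r m (next_trunk r m e))) (X, 0) else 0)
    + (if 0 < e then yw m R e * strip_sum r m R (x + 1, int (vpos r m (e - 1))) (X, 0) else 0)
    + (if horizontal r m (Suc e)
       then yw m R (Suc e) * strip_sum r m R (x + 2, int (vpos r m e)) (X, 0) else 0)"
proof -
  have le: "e \<le> Suc (2 * r)" using e by (simp add: trunk_iff)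
  have root: "(x, int (vpos r m e)) = (X, 0) \<longleftrightarrow> x = X \<and> e = 0"
    using vpos_pos_iff[of r m e] by auto
  show ?thesis
    using strip_sum_first_step[of "int (vpos r m e)" r m R x "(X, 0)"] root
      vpos_le_NN[OF le, of m] vpos_less_NN_iff[OF le, of m] vpos_pos_iff[of r m e]
      vpos_next_trunk(2)[of e r m] vpos_pred[OF e] down_wt_vpos[OF e, of R]
      has_horiz_vpos[OF e] horiz_wt_vpos[OF e, of R]
    by (auto simp: add.commute)
qed

section \<open>The weighted count of single paths\<close>

locale motzkin_qsys = nonvanishing_qsys r R
  for r :: nat and R :: "nat \<Rightarrow> int \<Rightarrow> 'a::field" +
  fixes m :: "nat \<Rightarrow> int"
  assumes motzkin: "asc_motzkin r m"
begin

lemma motzkin_conv_shift: "1 \<le> \<alpha> \<Longrightarrow> \<alpha> \<le> r \<Longrightarrow> m \<alpha> = shift r m \<alpha> + int \<alpha> - 1"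
proof (induction \<alpha> rule: nat_induct_at_least)
  case base
  then show ?case using motzkin by (simp add: asc_motzkin_def shift_Suc shift_0 hset_def)
next
  case (Suc \<alpha>)
  then have "\<alpha> \<in> {1..<r}" by simp
  with motzkin have "m (\<alpha> + 1) - m \<alpha> \<in> {0, 1}" unfolding asc_motzkin_def by blast
  moreover have "Suc \<alpha> \<in> hset r m \<longleftrightarrow> m (\<alpha> + 1) = m \<alpha>" using Suc by (auto simp: hset_def)
  ultimately show ?case using Suc by (auto simp: shift_Suc)
qed

lemma yw_even_conv_qd_e: "1 \<le> \<alpha> \<Longrightarrow> \<alpha> \<le> r \<Longrightarrow> yw m R (2 * \<alpha>) = qd_e \<alpha> (shift r m \<alpha>)"
  by (simp add: yw_def qd_e_def mu_def Q_eq_R motzkin_conv_shift algebra_simps)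

lemma yw_odd_conv_qd_q:
  assumes "\<alpha> \<le> r"
  shows "yw m R (Suc (2 * \<alpha>)) =
    (if Suc \<alpha> \<in> hset r m then qd_q (Suc \<alpha>) (shift r m \<alpha>) - qd_e (Suc \<alpha>) (shift r m \<alpha> - 1)
     else qd_q (Suc \<alpha>) (shift r m \<alpha>))"
proof -
  have lam: "lam R \<beta> (m \<beta>) = lam Q \<beta> (shift r m \<beta> + int \<beta> - 1)" if "\<beta> \<le> Suc r" for \<beta>
  proof -
    consider "\<beta> = 0" | "\<beta> = Suc r" | "1 \<le> \<beta>" "\<beta> \<le> r" using \<open>\<beta> \<le> Suc r\<close> by linarith
    then show ?thesis
      by cases (simp_all add: lam_def motzkin_conv_shift flip: Q_eq_R)
  qed
  have "yw m R (Suc (2 * \<alpha>))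
      = lam Q (Suc \<alpha>) (shift r m (Suc \<alpha>) + int \<alpha>) / lam Q \<alpha> (shift r m \<alpha> + int \<alpha> - 1)"
    using lam[of "Suc \<alpha>"] lam[of \<alpha>] assms by (simp add: yw_def Let_def)
  then show ?thesis
    using qd_q_minus_e_same_level[OF assms, of "shift r m \<alpha> - 1"]
    by (simp add: qd_q_Suc shift_Suc algebra_simps)
qed

text \<open>Up to the factor \<open>R\<^sub>1\<^sub>,\<^sub>0\<close>, the value \<open>edge_moment e t\<close> is the sum over paths of horizontal length
  \<open>2t - h\<close> from the upper end of edge \<open>e\<close>, at height \<open>h\<close>, down to height \<open>0\<close>.\<close>

definition edge_moment :: "nat \<Rightarrow> int \<Rightarrow> 'a" where
  "edge_moment e t = moment (e div 2) (shift r m ((e + 1) div 2) + int (e mod 2)) (t - int (e div 2))"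

lemma edge_moment_even: "edge_moment (2 * \<alpha>) t = moment \<alpha> (shift r m \<alpha>) (t - int \<alpha>)"
  by (simp add: edge_moment_def)

lemma edge_moment_odd: "edge_moment (Suc (2 * \<alpha>)) t = moment \<alpha> (shift r m (Suc \<alpha>) + 1) (t - int \<alpha>)"
  by (simp add: edge_moment_def)

lemma edge_moment_0: "edge_moment 0 t = R 1 t"
  by (simp add: edge_moment_def Q_eq_R)

lemma edge_moment_top: "edge_moment (Suc (Suc (2 * r))) t = 0"
  using edge_moment_even[of "Suc r" t] by (simp add: moment_top)

lemma edge_moment_horizontal:
  "horizontal r m (Suc e) \<Longrightarrow> edge_moment (Suc e) t = edge_moment e t"
  by (erule horizontal_SucE) (simp add: edge_moment_even edge_moment_odd shift_Suc)

lemma edge_moment_split_even_edge: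
  assumes "1 \<le> \<alpha>" "\<alpha> \<le> r"
  shows "edge_moment (2 * \<alpha>) t = moment \<alpha> (shift r m \<alpha> + 1) (t - int \<alpha>)
    + yw m R (2 * \<alpha>) * edge_moment (2 * \<alpha> - 1) (t - 1)"
proof -
  obtain \<beta> where \<beta>: "\<alpha> = Suc \<beta>" using assms by (cases \<alpha>) auto
  have "edge_moment (2 * \<alpha> - 1) (t - 1) = moment (\<alpha> - 1) (shift r m \<alpha> + 1) (t - int \<alpha>)"
    using edge_moment_odd[of \<beta> "t - 1"] by (simp add: \<beta> algebra_simps)
  then show ?thesis
    using moment_contiguous[of \<alpha> "shift r m \<alpha>" "t - int \<alpha>"] yw_even_conv_qd_e[OF assms]
      edge_moment_even[of \<alpha> t] by simp
qed

lemma moment_split_odd_edge: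
  assumes "\<alpha> \<le> r"
  shows "moment \<alpha> (shift r m \<alpha> + 1) (t - int \<alpha>)
    = edge_moment (Suc (Suc (2 * \<alpha>))) t + yw m R (Suc (2 * \<alpha>)) * edge_moment (2 * \<alpha>) (t - 1)"
proof -
  define n j where "n = shift r m \<alpha>" and "j = t - int \<alpha> - 1"
  have "edge_moment (Suc (Suc (2 * \<alpha>))) t = moment (Suc \<alpha>) (shift r m (Suc \<alpha>)) j"
    "edge_moment (2 * \<alpha>) (t - 1) = moment \<alpha> n j"
    using edge_moment_even[of "Suc \<alpha>" t] edge_moment_even[of \<alpha> "t - 1"]
    by (simp_all add: n_def j_def algebra_simps)
  then show ?thesis
    using moment_Suc[of \<alpha> n j] moment_Suc_backward[of \<alpha> n j] yw_odd_conv_qd_q[OF assms]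
    by (simp add: shift_Suc j_def flip: n_def)
qed

lemma edge_moment_first_step:
  assumes "e \<in> trunk r m"
  shows "edge_moment e t = (if e \<le> 2 * r then edge_moment (next_trunk r m e) t else 0)
    + (if 0 < e then yw m R e * edge_moment (e - 1) (t - 1) else 0)
    + (if horizontal r m (Suc e) then yw m R (Suc e) * edge_moment e (t - 1) else 0)"
proof (cases "even e")
  case True
  then obtain \<alpha> where \<alpha>: "e = 2 * \<alpha>" by blast
  then have "\<alpha> \<le> r" using assms by (simp add: trunk_iff)
  have "edge_moment e t = moment \<alpha> (shift r m \<alpha> + 1) (t - int \<alpha>)
      + (if 0 < e then yw m R e * edge_moment (e - 1) (t - 1) else 0)"
    using edge_moment_split_even_edge[of \<alpha> t] \<open>\<alpha> \<le> r\<close> \<alpha> by (cases "\<alpha> = 0") (auto simp: edge_moment_0 Q_eq_R)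
  moreover have "moment \<alpha> (shift r m \<alpha> + 1) (t - int \<alpha>) = edge_moment (next_trunk r m e) t
      + (if horizontal r m (Suc e) then yw m R (Suc e) * edge_moment e (t - 1) else 0)"
    using moment_split_odd_edge[OF \<open>\<alpha> \<le> r\<close>, of t] edge_moment_odd[of \<alpha> t]
    by (simp add: \<alpha> next_trunk_def horizontal_odd shift_Suc)
  ultimately show ?thesis using \<open>\<alpha> \<le> r\<close> \<alpha> by simp
next
  case False
  then obtain \<alpha> where \<alpha>: "e = Suc (2 * \<alpha>)" by (auto elim: oddE)
  then have "\<alpha> \<le> r" "Suc \<alpha> \<notin> hset r m" using assms by (auto simp: trunk_iff horizontal_odd)
  then have "edge_moment e t = edge_moment (Suc e) t + yw m R e * edge_moment (e - 1) (t - 1)"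
    using moment_split_odd_edge[of \<alpha> t] edge_moment_odd[of \<alpha> t] by (simp add: \<alpha> shift_Suc)
  moreover have "\<not> horizontal r m (Suc e)"
    using not_horizontal_even[of r m "Suc \<alpha>"] \<alpha> by simp
  moreover have "edge_moment (Suc e) t = 0" if "\<not> e \<le> 2 * r"
  proof -
    have "\<alpha> = r" using that \<alpha> \<open>\<alpha> \<le> r\<close> by simp
    then show ?thesis using \<alpha> edge_moment_top[of t] by simp
  qed
  ultimately show ?thesis using \<alpha> by (auto simp: next_trunk_def)
qed

text \<open>The orthogonality relations say that a path cannot end above height \<open>0\<close>.\<close>

lemma edge_moment_eq_0:
  assumes "1 \<le> e" "e \<le> Suc (2 * r)"
    and "2 * t = int (vpos r m e) \<or> 2 * t = int (vpos r m e) - 1 \<and> even e"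
  shows "edge_moment e t = 0"
proof (cases "even e")
  case True
  then obtain \<alpha> where \<alpha>: "e = 2 * \<alpha>" by blast
  then have t: "2 * t = int e + shift r m \<alpha> \<or> 2 * t = int e + shift r m \<alpha> - 1"
    using assms vpos_conv_shift[of e r m] by auto
  have "shift r m \<alpha> \<le> t - int \<alpha>" "t - int \<alpha> < shift r m \<alpha> + int \<alpha>"
    using t \<alpha> assms(1) shift_gt[of \<alpha> r m] shift_nonpos[of r m \<alpha>] by auto
  then show ?thesis unfolding \<alpha> edge_moment_even by (rule moment_eq_0)
next
  case False
  then obtain \<alpha> where \<alpha>: "e = Suc (2 * \<alpha>)" by (auto elim: oddE)
  then have t: "2 * t = int e + shift r m (Suc \<alpha>)"
    using assms False vpos_conv_shift[of e r m] by auto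
  have "shift r m (Suc \<alpha>) + 1 \<le> t - int \<alpha>" "t - int \<alpha> < shift r m (Suc \<alpha>) + 1 + int \<alpha>"
    using t \<alpha> shift_gt[of "Suc \<alpha>" r m] shift_nonpos[of r m "Suc \<alpha>"] by auto
  then show ?thesis unfolding \<alpha> edge_moment_odd by (rule moment_eq_0)
qed

lemma strip_sum_endpoint:
  assumes e: "e \<in> trunk r m" and t: "2 * t = int (vpos r m e)"
  shows "R 1 0 * strip_sum r m R (X, int (vpos r m e)) (X, 0) = edge_moment e t"
proof -
  have "strip_sum r m R (x, h) (X, 0) = 0" if "X < x" for x h
    using that by (intro strip.path_sum_eq_0) simp
  then have "strip_sum r m R (X, int (vpos r m e)) (X, 0) = (if e = 0 then 1 else 0)"
    using strip_sum_trunk_first_step[OF e, of R X X] by simp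
  then show ?thesis
    using e t edge_moment_eq_0[of e t] by (cases "e = 0") (auto simp: trunk_iff edge_moment_0)
qed

lemma strip_sum_side_step:
  assumes horiz: "horizontal r m (Suc e)" and x: "x < X" and t: "X - x = 2 * t - int (vpos r m e)"
    and within: "x + 2 \<le> X \<Longrightarrow>
      R 1 0 * strip_sum r m R (x + 2, int (vpos r m e)) (X, 0) = edge_moment e (t - 1)"
  shows "R 1 0 * strip_sum r m R (x + 2, int (vpos r m e)) (X, 0) = edge_moment e (t - 1)"
proof (cases "x + 2 \<le> X")
  case False
  then have "2 * (t - 1) = int (vpos r m e) - 1" using x t by simp
  moreover have "even e" "1 \<le> e" "e \<le> Suc (2 * r)" using horiz by (auto elim!: horizontal_SucE)
  moreover have "strip_sum r m R (x + 2, int (vpos r m e)) (X, 0) = 0"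
    using False by (intro strip.path_sum_eq_0) simp
  ultimately show ?thesis using edge_moment_eq_0[of e "t - 1"] by simp
qed (rule within)

theorem strip_sum_eq_edge_moment:
  assumes "e \<le> Suc (2 * r)" "X - x = 2 * t - int (vpos r m e)" "x \<le> X"
  shows "R 1 0 * strip_sum r m R (x, int (vpos r m e)) (X, 0) = edge_moment e t"
  using assms
proof (induction "nat (X - x)" arbitrary: x e t rule: less_induct)
  case less
  have IH: "R 1 0 * strip_sum r m R (x', int (vpos r m e')) (X, 0) = edge_moment e' t'"
    if "x < x'" "e' \<le> Suc (2 * r)" "X - x' = 2 * t' - int (vpos r m e')" "x' \<le> X" for x' e' t'
    using that less by auto
  have from_trunk: "R 1 0 * strip_sum r m R (x, int (vpos r m e)) (X, 0) = edge_moment e t"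
    if e: "e \<in> trunk r m" and t: "X - x = 2 * t - int (vpos r m e)" for e
  proof (cases "x = X")
    case True
    then show ?thesis using strip_sum_endpoint[OF e] t by simp
  next
    case False
    then have x: "x < X" using less.prems by simp
    have le: "e \<le> Suc (2 * r)" using e by (simp add: trunk_iff)
    have up: "R 1 0 * strip_sum r m R (x + 1, int (vpos r m (next_trunk r m e))) (X, 0)
        = edge_moment (next_trunk r m e) t" if "e \<le> 2 * r"
      using vpos_next_trunk[OF that] x t by (intro IH) auto
    have down: "R 1 0 * strip_sum r m R (x + 1, int (vpos r m (e - 1))) (X, 0)
        = edge_moment (e - 1) (t - 1)" if "0 < e"
      using vpos_pred[OF e that] x t le by (intro IH) auto
    have side: "R 1 0 * strip_sum r m R (x + 2, int (vpos r m e)) (X, 0) = edge_moment e (t - 1)"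
      if "horizontal r m (Suc e)"
      by (rule strip_sum_side_step[OF that x t], rule IH) (use t le in auto)
    show ?thesis
      unfolding strip_sum_trunk_first_step[OF e, of R x X] edge_moment_first_step[OF e, of t]
      using False up down side by (auto simp: distrib_left mult.left_commute)
  qed
  show ?case
  proof (cases "e \<in> trunk r m")
    case False
    then obtain e' where "e = Suc e'" "e' \<in> trunk r m" "horizontal r m (Suc e')" "vpos r m e = vpos r m e'"
      using trunk_representative less.prems(1) by metis
    then show ?thesis using from_trunk[of e'] less.prems(2) edge_moment_horizontal by simp
  qed (use from_trunk less.prems in blast)
qed

end

section \<open>Planarity and disjoint families\<close>

text \<open>Points with \<open>odd (x + f x)\<close> are the midpoints of horizontal steps.\<close>

definition height_profile :: "(int \<times> int) list \<Rightarrow> int \<Rightarrow> int \<Rightarrow> (int \<Rightarrow> int) \<Rightarrow> bool" where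
  "height_profile P a b f \<longleftrightarrow>
    (\<forall>x\<in>{a..b}. 0 \<le> f x \<and> (even (x + f x) \<longrightarrow> (x, f x) \<in> set P)) \<and>
    (\<forall>x\<in>{a..<b}. \<bar>f (x + 1) - f x\<bar> \<le> 1 \<and> (odd (x + f x) \<longrightarrow> f (x + 1) = f x))"

lemma height_profileD:
  assumes "height_profile P a b f"
  shows "a \<le> x \<Longrightarrow> x \<le> b \<Longrightarrow> 0 \<le> f x"
    and "a \<le> x \<Longrightarrow> x \<le> b \<Longrightarrow> even (x + f x) \<Longrightarrow> (x, f x) \<in> set P"
    and "a \<le> x \<Longrightarrow> x < b \<Longrightarrow> \<bar>f (x + 1) - f x\<bar> \<le> 1"
    and "a \<le> x \<Longrightarrow> x < b \<Longrightarrow> odd (x + f x) \<Longrightarrow> f (x + 1) = f x"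
  using assms by (auto simp: height_profile_def)

lemma height_profile_Cons:
  assumes f: "height_profile P a' b f" "f a' = h'" and "a' \<le> b"
    and step: "a' = a + 1 \<and> \<bar>h' - h\<bar> \<le> 1 \<or> a' = a + 2 \<and> h' = h" and "even (a + h)" "0 \<le> h"
  shows "height_profile ((a, h) # P) a b (\<lambda>x. if x < a' then h else f x)"
proof -
  let ?g = "\<lambda>x. if x < a' then h else f x"
  note tail = height_profileD[OF f(1)]
  have "0 \<le> ?g x \<and> (even (x + ?g x) \<longrightarrow> (x, ?g x) \<in> set ((a, h) # P))" if "x \<in> {a..b}" for x
  proof (cases "x < a'")
    case True
    then have "x = a \<or> x = a + 1 \<and> a' = a + 2" using that step by auto
    then show ?thesis using True \<open>even (a + h)\<close> \<open>0 \<le> h\<close> by auto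
  qed (use that tail(1,2)[of x] in auto)
  moreover have "\<bar>?g (x + 1) - ?g x\<bar> \<le> 1 \<and> (odd (x + ?g x) \<longrightarrow> ?g (x + 1) = ?g x)" if "x \<in> {a..<b}" for x
  proof -
    consider "x + 1 < a'" | "x + 1 = a'" | "a' \<le> x" by linarith
    then show ?thesis
    proof cases
      case 2
      then show ?thesis using step f(2) \<open>even (a + h)\<close> by auto
    qed (use that tail(3,4)[of x] in auto)
  qed
  ultimately show ?thesis unfolding height_profile_def by blast
qed

lemma ex_height_profile:
  assumes "P \<in> paths (strip_step r m) (a, h) (b, h')" "even (a + h)" "0 \<le> h"
  shows "\<exists>f. height_profile P a b f \<and> f a = h \<and> f b = h'"
  using assms
proof (induction P arbitrary: a h rule: induct_list012)
  case (2 p)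
  then show ?case
    by (intro exI[of _ "\<lambda>_. h"]) (auto simp: paths_def height_profile_def)
next
  case (3 p q P)
  obtain a' h1 where q: "q = (a', h1)" by (cases q)
  have p: "p = (a, h)" and step: "strip_step r m (a, h) (a', h1)"
    and qP: "q # P \<in> paths (strip_step r m) (a', h1) (b, h')"
    using 3(3) by (auto simp: paths_def q)
  have step_cases: "a' = a + 1 \<and> (h1 = h + 1 \<or> h1 = h - 1) \<or> a' = a + 2 \<and> h1 = h" and "0 \<le> h1"
    using step by (auto simp: strip_step_def step_ok_def)
  moreover from this have "even (a' + h1)" using 3(4) by auto
  ultimately obtain f where f: "height_profile (q # P) a' b f" "f a' = h1" "f b = h'"
    using 3(2)[OF qP] by blast
  have "a' \<le> b" using strip.rank_le_if_path[OF qP] by simp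
  then have "height_profile ((a, h) # q # P) a b (\<lambda>x. if x < a' then h else f x)"
    using f step_cases 3(4,5) by (intro height_profile_Cons) auto
  moreover have "a < a'" using step_cases by auto
  ultimately show ?case
    using f(3) \<open>a' \<le> b\<close> by (intro exI[of _ "\<lambda>x. if x < a' then h else f x"]) (simp add: p)
qed (simp add: paths_def)

text \<open>If \<open>f - g\<close> jumped from \<open>1\<close> to \<open>- 1\<close>, both functions would change at a point \<open>x\<close> where one of
  \<open>x + f x\<close> and \<open>x + g x\<close> is odd.\<close>

lemma crossing_heights_meet:
  fixes f g :: "int \<Rightarrow> int"
  assumes "a \<le> b" "g a \<le> f a" "f b \<le> g b"
    and f: "\<And>x. a \<le> x \<Longrightarrow> x < b \<Longrightarrow> \<bar>f (x + 1) - f x\<bar> \<le> 1"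
      "\<And>x. a \<le> x \<Longrightarrow> x < b \<Longrightarrow> odd (x + f x) \<Longrightarrow> f (x + 1) = f x"
    and g: "\<And>x. a \<le> x \<Longrightarrow> x < b \<Longrightarrow> \<bar>g (x + 1) - g x\<bar> \<le> 1"
      "\<And>x. a \<le> x \<Longrightarrow> x < b \<Longrightarrow> odd (x + g x) \<Longrightarrow> g (x + 1) = g x"
  shows "\<exists>x\<in>{a..b}. f x = g x"
proof (rule ccontr)
  assume "\<not> (\<exists>x\<in>{a..b}. f x = g x)"
  then have differ: "f x \<noteq> g x" if "a \<le> x" "x \<le> b" for x
    using that by auto
  have "g x < f x" if "a \<le> x" "x \<le> b" for x
    using that
  proof (induction x rule: int_ge_induct)
    case base
    then show ?case using differ[of a] \<open>g a \<le> f a\<close> by simp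
  next
    case (step x)
    then have less: "g x < f x" and x: "a \<le> x" "x < b" by auto
    show ?case
    proof (rule ccontr)
      assume "\<not> g (x + 1) < f (x + 1)"
      then have "f (x + 1) < g (x + 1)" using differ[of "x + 1"] step by simp
      then have "f x = g x + 1" "f (x + 1) \<noteq> f x" "g (x + 1) \<noteq> g x"
        using less f(1)[OF x] g(1)[OF x] by linarith+
      then show False using f(2)[OF x] g(2)[OF x] by auto
    qed
  qed
  from this[of b] show False using \<open>a \<le> b\<close> \<open>f b \<le> g b\<close> by simp
qed

lemma crossing_profiles_meet:
  assumes f: "height_profile P a b f" "f b = 0" and g: "height_profile P' a' b' g" "g a' = 0"
    and "even b" "a \<le> a'" "a' \<le> b" "b \<le> b'"
  shows "set P \<inter> set P' \<noteq> {}"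
proof -
  note f_profile = height_profileD[OF f(1)] and g_profile = height_profileD[OF g(1)]
  have "\<exists>x\<in>{a'..b}. f x = g x"
  proof (rule crossing_heights_meet)
    show "g a' \<le> f a'" "f b \<le> g b"
      using f_profile(1)[of a'] g_profile(1)[of b] f(2) g(2) assms(6-8) by simp_all
    fix x assume "a' \<le> x" "x < b"
    then have "a \<le> x" "x < b'" using assms(6,8) by simp_all
    show "\<bar>f (x + 1) - f x\<bar> \<le> 1" "odd (x + f x) \<Longrightarrow> f (x + 1) = f x"
      by (rule f_profile(3,4)[OF \<open>a \<le> x\<close> \<open>x < b\<close>])+
    show "\<bar>g (x + 1) - g x\<bar> \<le> 1" "odd (x + g x) \<Longrightarrow> g (x + 1) = g x"
      by (rule g_profile(3,4)[OF \<open>a' \<le> x\<close> \<open>x < b'\<close>])+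
  qed (rule \<open>a' \<le> b\<close>)
  then obtain x where x: "a' \<le> x" "x \<le> b" "f x = g x" by auto
  have common_vertex: "set P \<inter> set P' \<noteq> {}" if "a' \<le> z" "z \<le> b" "even (z + f z)" "f z = g z" for z
    using that f_profile(2)[of z] g_profile(2)[of z] assms(6-8) by auto
  show ?thesis
  proof (cases "even (x + f x)")
    case False
    then have "x < b" using x(2) f(2) \<open>even b\<close> by (cases "x = b") auto
    then have "f (x + 1) = f x" "g (x + 1) = g x"
      using False x f_profile(4)[of x] g_profile(4)[of x] assms(6-8) by auto
    then show ?thesis using common_vertex[of "x + 1"] False x \<open>x < b\<close> by auto
  qed (use common_vertex x in blast)
qed

lemma crossing_paths_meet:
  assumes "P \<in> paths (strip_step r m) (a, 0) (b, 0)" "P' \<in> paths (strip_step r m) (a', 0) (b', 0)"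
    and "even a" "even a'" "even b" "a \<le> a'" "a' \<le> b" "b \<le> b'"
  shows "set P \<inter> set P' \<noteq> {}"
proof -
  obtain f where f: "height_profile P a b f" "f b = 0"
    using ex_height_profile[OF assms(1)] assms(3) by auto
  obtain g where g: "height_profile P' a' b' g" "g a' = 0"
    using ex_height_profile[OF assms(2)] assms(4) by auto
  show ?thesis using crossing_profiles_meet[OF f g assms(5-8)] .
qed

definition source :: "nat \<Rightarrow> int \<times> int" where
  "source i = (2 * int i, 0)"

definition sink :: "int \<Rightarrow> nat \<Rightarrow> nat \<Rightarrow> int \<times> int" where
  "sink n k j = (2 * n + 2 * int k - 2 * int j - 2, 0)"

lemma disjoint_families_unpermuted:
  assumes n: "int k - 1 \<le> n" and \<sigma>: "\<sigma> permutes {0..<k}"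
    and Ps: "Ps \<in> path_families (strip_step r m) k source (sink n k \<circ> \<sigma>)"
    and disjoint: "vertex_disjoint Ps"
  shows "\<sigma> = id"
proof -
  have less: "\<sigma> i < \<sigma> j" if "i < j" "j < k" for i j
  proof (rule ccontr)
    assume "\<not> \<sigma> i < \<sigma> j"
    have path: "Ps ! l \<in> paths (strip_step r m) (2 * int l, 0) (2 * n + 2 * int k - 2 * int (\<sigma> l) - 2, 0)"
      if "l < k" for l
      using that Ps by (simp add: path_families_def source_def sink_def)
    have "\<sigma> i < k" using permutes_in_image[OF \<sigma>, of i] that by simp
    then have "set (Ps ! i) \<inter> set (Ps ! j) \<noteq> {}"
      using \<open>\<not> \<sigma> i < \<sigma> j\<close> that n by (intro crossing_paths_meet[OF path path]) auto
    then show False using disjoint that Ps by (auto simp: vertex_disjoint_def path_families_def)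
  qed
  have "i \<le> \<sigma> i" if "i < k" for i
    using that
  proof (induction i)
    case (Suc i)
    then show ?case using less[of i "Suc i"] by simp
  qed simp
  then show ?thesis using permutes_natset_ge[OF \<sigma>] by simp
qed

lemma in_paths_restrict_iff:
  assumes "a \<in> S"
  shows "P \<in> paths (\<lambda>p q. p \<in> S \<and> q \<in> S \<and> step p q) a b \<longleftrightarrow> P \<in> paths step a b \<and> set P \<subseteq> S"
  using assms
proof (induction P arbitrary: a rule: induct_list012)
  case (3 p q P)
  then show ?case using "3.IH"(2)[of q] by (auto simp: paths_def)
qed (auto simp: paths_def)

lemma is_lpath_iff: "is_lpath r m P (x, 0) E \<longleftrightarrow> P \<in> paths (strip_step r m) (x, 0) E"
proof -
  have "strip_step r m = (\<lambda>p q. p \<in> {p. snd p \<in> {0..int (NN r m)}} \<and> q \<in> {p. snd p \<in> {0..int (NN r m)}}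
      \<and> step_ok r m p q)"
    by (simp add: strip_step_def fun_eq_iff)
  then have "P \<in> paths (strip_step r m) (x, 0) E
      \<longleftrightarrow> P \<in> paths (step_ok r m) (x, 0) E \<and> set P \<subseteq> {p. snd p \<in> {0..int (NN r m)}}"
    by (simp only:) (rule in_paths_restrict_iff, simp)
  then show ?thesis
    by (auto simp: is_lpath_def paths_def successively_conv_nth)
qed

lemma (in motzkin_qsys) R_eq_det_strip_sums:
  assumes k: "k \<le> r" and n: "int k - 1 \<le> n"
  shows "R k n = R 1 0 ^ k * det (mat k k (\<lambda>(i, j). strip_sum r m R (source i) (sink n k j)))"
proof -
  let ?G = "mat k k (\<lambda>(i, j). strip_sum r m R (source i) (sink n k j))"
  define H where "H i j = Q (Suc 0) (n - int k + 1 + int i + int j)" for i j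
  have "R k n = det (mat k k (\<lambda>(i, j). H i j))"
    using hankel_det_Q[of k "n - int k + 1"] k by (simp add: Q_eq_R H_def)
  also have "\<dots> = det (mat k k (\<lambda>(i, j). H (k - 1 - i) (k - 1 - j)))"
    by (rule det_reverse_rows_cols[symmetric])
  also have "mat k k (\<lambda>(i, j). H (k - 1 - i) (k - 1 - j)) = R 1 0 \<cdot>\<^sub>m ?G"
  proof (rule eq_matI)
    fix i j assume "i < dim_row (R 1 0 \<cdot>\<^sub>m ?G)" "j < dim_col (R 1 0 \<cdot>\<^sub>m ?G)"
    then have ij: "i < k" "j < k" by auto
    define t where "t = n + int k - 1 - int i - int j"
    have "R 1 0 * strip_sum r m R (2 * int i, int (vpos r m 0)) (2 * n + 2 * int k - 2 * int j - 2, 0)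
        = edge_moment 0 t"
      using ij n by (intro strip_sum_eq_edge_moment) (auto simp: t_def)
    moreover have "H (k - 1 - i) (k - 1 - j) = R 1 t"
      using ij by (simp add: H_def Q_eq_R t_def algebra_simps)
    ultimately show "mat k k (\<lambda>(i, j). H (k - 1 - i) (k - 1 - j)) $$ (i, j) = (R 1 0 \<cdot>\<^sub>m ?G) $$ (i, j)"
      using ij by (simp add: source_def sink_def edge_moment_0)
  qed auto
  finally show ?thesis by simp
qed

theorem mainTheorem13:
  fixes r k :: nat and n :: int and m :: "nat \<Rightarrow> int" and R :: "nat \<Rightarrow> int \<Rightarrow> 'a::field"
  assumes "r \<ge> 1"
    and "qsys r R"
    and "\<forall>\<alpha>\<in>{1..r}. \<forall>j. R \<alpha> j \<noteq> 0"
    and "asc_motzkin r m"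
    and "1 \<le> k" and "k \<le> r" and "n \<ge> int k - 1"
  shows "R k n = (R 1 0) ^ k *
    (\<Sum>Ps \<in> {Ps. length Ps = k \<and>
          (\<forall>i<k. is_lpath r m (Ps!i) (2 * int i, 0) (2*n + 2 * int k - 2 * int i - 2, 0)) \<and>
          (\<forall>i<k. \<forall>j<k. i \<noteq> j \<longrightarrow> set (Ps!i) \<inter> set (Ps!j) = {})}.
       \<Prod>i<k. path_wt r m R (Ps!i))" (is "_ = _ * (\<Sum>Ps\<in>?disjoint. _)")
proof -
  interpret motzkin_qsys r R m
    by unfold_locales (use assms in auto)
  have "R k n = R 1 0 ^ k * det (mat k k (\<lambda>(i, j). strip_sum r m R (source i) (sink n k j)))"
    using assms(6,7) by (rule R_eq_det_strip_sums)
  also have "det (mat k k (\<lambda>(i, j). strip_sum r m R (source i) (sink n k j))) =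
      (\<Sum>Ps | Ps \<in> path_families (strip_step r m) k source (sink n k) \<and> vertex_disjoint Ps.
        \<Prod>i<k. weight (step_wt r m R) (Ps ! i))"
    using disjoint_families_unpermuted[OF assms(7)] by (rule strip.lindstrom_gessel_viennot)
  also have "{Ps. Ps \<in> path_families (strip_step r m) k source (sink n k) \<and> vertex_disjoint Ps} = ?disjoint"
    by (auto simp: path_families_def vertex_disjoint_def is_lpath_iff source_def sink_def)
  finally show ?thesis
    by (simp add: path_wt_def weight_conv_prod)
qed

end
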